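(* Let $A$ be a von Neumann hyperring and let $$S_u=\bigcup\{e_1+\cdots+e_n : \{e_1,\dots,e_n\}\text{ is a partition of unity of }A\}.$$ Then $A/_mS_u$ is a geometric von Neumann hyperring, and for every multiring morphism $f\colon A\to B$ with $B$ a mono-multiring there exists a unique multiring morphism $\overline f\colon A/_mS_u\to B$ such that $\overline f\circ\pi=f$, where $\pi\colon A\to A/_mS_u$ is the canonical map.
   Context: A multiring is a tuple $(A,+,-,\cdot,0,1)$ where $(A,\cdot,1)$ is a commutative monoid, $+\colon A\times A\to\{\text{nonempty subsets of }A\}$ and $-\colon A\to A$ are functions and $0\in A$, such that for all $a,b,c,d\in A$: (1) $a\in b+c$ implies $c\in -b+a$ and $b\in a+(-c)$; (2) $a\in b+0$ iff $a=b$; (3) if $x\in g+c$ with $g\in a+b$, then there is $h\in b+c$ with $x\in a+h$; (4) $a+b=b+a$; (5) $a\cdot 0=0$; (6) $a\in b+c$ implies $ad\in bd+cd$. Sums of subsets are unions of elementwise sums, and $e_1+\cdots+e_n$ is the iterated sum (a subset of $A$). A hyperring is a multiring such that $x\in bd+cd$ implies $x=ad$ for some $a\in b+c$. A morphism of multirings $f$ satisfies $f(a)\in f(b)+f(c)$ whenever $a\in b+c$, and preserves $\cdot,-,0,1$. An ideal is a nonempty $\alpha\subseteq A$ with $\alpha+\alpha\subseteq\alpha$, $A\alpha\subseteq\alpha$; it is prime if $1\notin\alpha$ and $ab\in\alpha$ implies $a\in\alpha$ or $b\in\alpha$. $\mathrm{spec}(A)$ is the set of prime ideals with the topology with basis $D(a)=\{p: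 a\notin p\}$. $(x)$ denotes the ideal generated by $x$. A von Neumann hyperring is a hyperring $A$ such that for all $a\in A$ there is $b\in A$ with $a=a^2b$. A partition of unity is a finite family $\{e_1,\dots,e_n\}$ of idempotents of $A$ with $e_ie_j=0$ for $i\ne j$ and $1\in e_1+\cdots+e_n$. The set $S_u$ is multiplicative. Marshall quotient: for a multiplicative set $S\subseteq A$ ($1\in S$, $SS\subseteq S$), $A/_mS$ is the set of classes of $a\sim b\Leftrightarrow as=bt$ for some $s,t\in S$, with $\overline a\,\overline b=\overline{ab}$, $-\overline a=\overline{-a}$, and $\overline a\in\overline b+\overline c$ iff $as\in bt+cu$ for some $s,t,u\in S$; it is a multiring and $a\mapsto\overline a$ is a morphism. Localization: $S^{-1}A$ is the multiring of fractions $a/s$, with $a/s=b/t$ iff $atu=bsu$ for some $u\in S$, $a/s\in b/t+c/u$ iff $atuv\in bsuv+cstv$ for some $v\in S$, and $(a/s)(b/t)=ab/st$. $A_a=\{1,a,a^2,\dots\}^{-1}A$. For a multiring $A$ and $a\in A$ let $S_a=\{x\in A:\exists n\ge0,\ a^n\in(x)\}$ (with $0^0=1$). The structural presheaf $\mathcal F=\mathcal F_A$ is defined on basic opens by $\mathcal F(D(a))=S_a^{-1}A$; if $D(a)\subseteq D(b)$ then $S_b\subseteq S_a$ and the restriction $\mathcal F_{b,a}\colon S_b^{-1}A\to S_a^{-1}A$ is the canonical morphism. Since $\{1,e,e^2,\dots\}\subseteq S_e$ there is a canonical morphism $A_e\to S_e^{-1}A$ (an isomorphism if $A$ is a hyperring),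 and $\mathcal F_{e,e_i}$ is also applied to elements of $A_e$ through it. $A$ is a mono-multiring ($\mathcal F$ is a monopresheaf) if for every cover $D(e)=\bigcup_{i\in I}D(e_i)$ and $a,b,c\in A_e$ with $\mathcal F_{e,e_i}(a)\in\mathcal F_{e,e_i}(b)+\mathcal F_{e,e_i}(c)$ in $\mathcal F(D(e_i))$ for all $i$, one has $a\in b+c$ in $A_e$. $\mathcal F$ is a sheaf if it is a monopresheaf and, for every cover $D(e)=\bigcup_{i\in I}D(e_i)$ and elements $x_i\in\mathcal F(D(e_i))$ with $\mathcal F_{e_i,e_ie_j}(x_i)=\mathcal F_{e_j,e_ie_j}(x_j)$ for all $i,j$, there is $x\in\mathcal F(D(e))$ with $\mathcal F_{e,e_i}(x)=x_i$ for all $i$. $A$ is geometric if $\mathcal F_A$ is a sheaf. *)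

theory Defs
  imports "HOL-Algebra.Group"
begin

section \<open>Multirings and hyperrings\<close>

record 'a multiring = "'a monoid" +
  mzero :: 'a ("\<zero>\<index>")
  hadd :: "'a \<Rightarrow> 'a \<Rightarrow> 'a set" (infixl "\<boxplus>\<index>" 65)
  hneg :: "'a \<Rightarrow> 'a" ("\<boxminus>\<index> _" [81] 80)

locale multiring = comm_monoid A for A :: "('a, 'm) multiring_scheme" (structure) +
  assumes zero_closed: "\<zero> \<in> carrier A"
    and neg_closed: "a \<in> carrier A \<Longrightarrow> \<boxminus> a \<in> carrier A"
    and add_closed: "\<lbrakk>a \<in> carrier A; b \<in> carrier A\<rbrakk> \<Longrightarrow> a \<boxplus> b \<subseteq> carrier A"
    and add_nonempty: "\<lbrakk>a \<in> carrier A; b \<in> carrier A\<rbrakk> \<Longrightarrow> a \<boxplus> b \<noteq> {}"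
    and add_reversible:
      "\<lbrakk>a \<in> carrier A; b \<in> carrier A; c \<in> carrier A; a \<in> b \<boxplus> c\<rbrakk>
        \<Longrightarrow> c \<in> (\<boxminus> b) \<boxplus> a \<and> b \<in> a \<boxplus> (\<boxminus> c)"
    and add_zero: "\<lbrakk>a \<in> carrier A; b \<in> carrier A\<rbrakk> \<Longrightarrow> a \<in> b \<boxplus> \<zero> \<longleftrightarrow> a = b"
    and add_assoc:
      "\<lbrakk>a \<in> carrier A; b \<in> carrier A; c \<in> carrier A; g \<in> a \<boxplus> b; x \<in> g \<boxplus> c\<rbrakk>
        \<Longrightarrow> \<exists>h \<in> b \<boxplus> c. x \<in> a \<boxplus> h"
    and add_comm: "\<lbrakk>a \<in> carrier A; b \<in> carrier A\<rbrakk> \<Longrightarrow> a \<boxplus> b = b \<boxplus> a"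
    and mult_zero: "a \<in> carrier A \<Longrightarrow> a \<otimes> \<zero> = \<zero>"
    and weak_distrib:
      "\<lbrakk>a \<in> carrier A; b \<in> carrier A; c \<in> carrier A; d \<in> carrier A; a \<in> b \<boxplus> c\<rbrakk>
        \<Longrightarrow> a \<otimes> d \<in> (b \<otimes> d) \<boxplus> (c \<otimes> d)"

locale hyperring = multiring +
  assumes strong_distrib:
    "\<lbrakk>b \<in> carrier A; c \<in> carrier A; d \<in> carrier A; x \<in> (b \<otimes> d) \<boxplus> (c \<otimes> d)\<rbrakk>
      \<Longrightarrow> \<exists>a \<in> b \<boxplus> c. x = a \<otimes> d"

locale von_neumann_hyperring = hyperring +
  assumes von_neumann_regular:
    "a \<in> carrier A \<Longrightarrow> \<exists>b \<in> carrier A. a = (a \<otimes> a) \<otimes> b"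

definition multiring_hom ::
    "('a, 'm) multiring_scheme \<Rightarrow> ('b, 'n) multiring_scheme \<Rightarrow> ('a \<Rightarrow> 'b) set" where
  "multiring_hom A B =
    {f \<in> carrier A \<rightarrow> carrier B.
      (\<forall>a \<in> carrier A. \<forall>b \<in> carrier A. \<forall>c \<in> carrier A.
          a \<in> b \<boxplus>\<^bsub>A\<^esub> c \<longrightarrow> f a \<in> f b \<boxplus>\<^bsub>B\<^esub> f c) \<and>
      (\<forall>a \<in> carrier A. \<forall>b \<in> carrier A. f (a \<otimes>\<^bsub>A\<^esub> b) = f a \<otimes>\<^bsub>B\<^esub> f b) \<and>
      (\<forall>a \<in> carrier A. f (\<boxminus>\<^bsub>A\<^esub> a) = \<boxminus>\<^bsub>B\<^esub> f a) \<and>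
      f \<zero>\<^bsub>A\<^esub> = \<zero>\<^bsub>B\<^esub> \<and> f \<one>\<^bsub>A\<^esub> = \<one>\<^bsub>B\<^esub>}"


section \<open>Partitions of unity\<close>

text \<open>The empty sum is \<open>{\<zero>}\<close>; since \<open>x \<boxplus> \<zero> = {x}\<close>, this is
  the iterated sum \<open>e\<^sub>1 \<boxplus> \<dots> \<boxplus> e\<^sub>n\<close> for every nonempty list.\<close>

definition hsum :: "('a, 'm) multiring_scheme \<Rightarrow> 'a list \<Rightarrow> 'a set" where
  "hsum A es = foldr (\<lambda>e X. \<Union>x \<in> X. e \<boxplus>\<^bsub>A\<^esub> x) es {\<zero>\<^bsub>A\<^esub>}"

text \<open>A finite family is a list, so orthogonality is required for distinct positions,
  not merely for distinct values.\<close>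

definition partition_of_unity :: "('a, 'm) multiring_scheme \<Rightarrow> 'a list \<Rightarrow> bool" where
  "partition_of_unity A es \<longleftrightarrow>
    set es \<subseteq> carrier A \<and>
    (\<forall>e \<in> set es. e \<otimes>\<^bsub>A\<^esub> e = e) \<and>
    (\<forall>i < length es. \<forall>j < length es. i \<noteq> j \<longrightarrow> es ! i \<otimes>\<^bsub>A\<^esub> es ! j = \<zero>\<^bsub>A\<^esub>) \<and>
    \<one>\<^bsub>A\<^esub> \<in> hsum A es"

definition S_u :: "('a, 'm) multiring_scheme \<Rightarrow> 'a set" where
  "S_u A = \<Union>{hsum A es | es. partition_of_unity A es}"


section \<open>The Marshall quotient\<close>

definition marshall_proj :: "('a, 'm) multiring_scheme \<Rightarrow> 'a set \<Rightarrow> 'a \<Rightarrow> 'a set" where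
  "marshall_proj A S a =
    {b \<in> carrier A. \<exists>s \<in> S. \<exists>t \<in> S. a \<otimes>\<^bsub>A\<^esub> s = b \<otimes>\<^bsub>A\<^esub> t}"

text \<open>Here and for localizations, an operation given on representatives is written as the
  union of the classes obtained from all representatives; for multiplicative \<open>S\<close>
  these classes coincide.\<close>

definition marshall_quotient :: "('a, 'm) multiring_scheme \<Rightarrow> 'a set \<Rightarrow> 'a set multiring" where
  "marshall_quotient A S =
    \<lparr>carrier = marshall_proj A S ` carrier A,
     mult = (\<lambda>X Y. \<Union>a \<in> X. \<Union>b \<in> Y. marshall_proj A S (a \<otimes>\<^bsub>A\<^esub> b)),
     one = marshall_proj A S \<one>\<^bsub>A\<^esub>,
     mzero = marshall_proj A S \<zero>\<^bsub>A\<^esub>,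
     hadd = (\<lambda>Y Z. {X \<in> marshall_proj A S ` carrier A.
        \<exists>a \<in> X. \<exists>b \<in> Y. \<exists>c \<in> Z. \<exists>s \<in> S. \<exists>t \<in> S. \<exists>u \<in> S.
          a \<otimes>\<^bsub>A\<^esub> s \<in> (b \<otimes>\<^bsub>A\<^esub> t) \<boxplus>\<^bsub>A\<^esub> (c \<otimes>\<^bsub>A\<^esub> u)}),
     hneg = (\<lambda>X. \<Union>a \<in> X. marshall_proj A S (\<boxminus>\<^bsub>A\<^esub> a))\<rparr>"


section \<open>Localization\<close>

text \<open>\<open>frac A S a s\<close> is the class \<open>a/s\<close>.\<close>

definition frac :: "('a, 'm) multiring_scheme \<Rightarrow> 'a set \<Rightarrow> 'a \<Rightarrow> 'a \<Rightarrow> ('a \<times> 'a) set" where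
  "frac A S a s =
    {(b, t) \<in> carrier A \<times> S. \<exists>u \<in> S. a \<otimes>\<^bsub>A\<^esub> t \<otimes>\<^bsub>A\<^esub> u = b \<otimes>\<^bsub>A\<^esub> s \<otimes>\<^bsub>A\<^esub> u}"

definition localization ::
    "('a, 'm) multiring_scheme \<Rightarrow> 'a set \<Rightarrow> ('a \<times> 'a) set multiring" where
  "localization A S =
    \<lparr>carrier = {frac A S a s | a s. a \<in> carrier A \<and> s \<in> S},
     mult = (\<lambda>X Y. \<Union>(a, s) \<in> X. \<Union>(b, t) \<in> Y. frac A S (a \<otimes>\<^bsub>A\<^esub> b) (s \<otimes>\<^bsub>A\<^esub> t)),
     one = frac A S \<one>\<^bsub>A\<^esub> \<one>\<^bsub>A\<^esub>,
     mzero = frac A S \<zero>\<^bsub>A\<^esub> \<one>\<^bsub>A\<^esub>,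
     hadd = (\<lambda>Y Z. {X. (\<exists>a \<in> carrier A. \<exists>s \<in> S. X = frac A S a s) \<and>
        (\<exists>(a, s) \<in> X. \<exists>(b, t) \<in> Y. \<exists>(c, u) \<in> Z. \<exists>v \<in> S.
          a \<otimes>\<^bsub>A\<^esub> t \<otimes>\<^bsub>A\<^esub> u \<otimes>\<^bsub>A\<^esub> v
            \<in> (b \<otimes>\<^bsub>A\<^esub> s \<otimes>\<^bsub>A\<^esub> u \<otimes>\<^bsub>A\<^esub> v) \<boxplus>\<^bsub>A\<^esub> (c \<otimes>\<^bsub>A\<^esub> s \<otimes>\<^bsub>A\<^esub> t \<otimes>\<^bsub>A\<^esub> v))}),
     hneg = (\<lambda>X. \<Union>(a, s) \<in> X. frac A S (\<boxminus>\<^bsub>A\<^esub> a) s)\<rparr>"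

text \<open>The canonical morphism \<open>a/s \<mapsto> a/s\<close> from \<open>S\<^sup>-\<^sup>1A\<close> to \<open>T\<^sup>-\<^sup>1A\<close>, meaningful for \<open>S \<subseteq> T\<close>.\<close>

definition localization_map ::
    "('a, 'm) multiring_scheme \<Rightarrow> 'a set \<Rightarrow> 'a set \<Rightarrow> ('a \<times> 'a) set \<Rightarrow> ('a \<times> 'a) set" where
  "localization_map A S T =
    (\<lambda>X \<in> carrier (localization A S). \<Union>(a, s) \<in> X. frac A T a s)"

definition powers :: "('a, 'm) multiring_scheme \<Rightarrow> 'a \<Rightarrow> 'a set" where
  "powers A a = {a [^]\<^bsub>A\<^esub> n | n :: nat. True}"


section \<open>The spectrum and its structural presheaf\<close>

definition multiring_ideal :: "('a, 'm) multiring_scheme \<Rightarrow> 'a set \<Rightarrow> bool" where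
  "multiring_ideal A I \<longleftrightarrow>
    I \<noteq> {} \<and> I \<subseteq> carrier A \<and>
    (\<forall>x \<in> I. \<forall>y \<in> I. x \<boxplus>\<^bsub>A\<^esub> y \<subseteq> I) \<and>
    (\<forall>a \<in> carrier A. \<forall>x \<in> I. a \<otimes>\<^bsub>A\<^esub> x \<in> I)"

definition multiring_prime_ideal :: "('a, 'm) multiring_scheme \<Rightarrow> 'a set \<Rightarrow> bool" where
  "multiring_prime_ideal A P \<longleftrightarrow>
    multiring_ideal A P \<and> \<one>\<^bsub>A\<^esub> \<notin> P \<and>
    (\<forall>a \<in> carrier A. \<forall>b \<in> carrier A. a \<otimes>\<^bsub>A\<^esub> b \<in> P \<longrightarrow> a \<in> P \<or> b \<in> P)"

definition multiring_spec :: "('a, 'm) multiring_scheme \<Rightarrow> 'a set set" where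
  "multiring_spec A = {P. multiring_prime_ideal A P}"

definition basic_open :: "('a, 'm) multiring_scheme \<Rightarrow> 'a \<Rightarrow> 'a set set" where
  "basic_open A a = {P \<in> multiring_spec A. a \<notin> P}"

definition principal_ideal :: "('a, 'm) multiring_scheme \<Rightarrow> 'a \<Rightarrow> 'a set" where
  "principal_ideal A x = \<Inter>{I. multiring_ideal A I \<and> x \<in> I}"

definition S_of :: "('a, 'm) multiring_scheme \<Rightarrow> 'a \<Rightarrow> 'a set" where
  "S_of A a = {x \<in> carrier A. \<exists>n :: nat. a [^]\<^bsub>A\<^esub> n \<in> principal_ideal A x}"

text \<open>\<open>presheaf A a\<close> stands for the value at \<open>basic_open A a\<close>: the set \<open>S_of A a\<close>
  depends only on \<open>basic_open A a\<close>.\<close>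

definition presheaf :: "('a, 'm) multiring_scheme \<Rightarrow> 'a \<Rightarrow> ('a \<times> 'a) set multiring" where
  "presheaf A a = localization A (S_of A a)"

definition presheaf_restr ::
    "('a, 'm) multiring_scheme \<Rightarrow> 'a \<Rightarrow> 'a \<Rightarrow> ('a \<times> 'a) set \<Rightarrow> ('a \<times> 'a) set" where
  "presheaf_restr A b a = localization_map A (S_of A b) (S_of A a)"

definition localize_at :: "('a, 'm) multiring_scheme \<Rightarrow> 'a \<Rightarrow> ('a \<times> 'a) set multiring" where
  "localize_at A e = localization A (powers A e)"

definition localize_at_to_presheaf ::
    "('a, 'm) multiring_scheme \<Rightarrow> 'a \<Rightarrow> ('a \<times> 'a) set \<Rightarrow> ('a \<times> 'a) set" where
  "localize_at_to_presheaf A e = localization_map A (powers A e) (S_of A e)"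

text \<open>A cover of \<open>D(e)\<close> by basic opens is given by the set \<open>E\<close> of the elements \<open>e\<^sub>i\<close>, and is
  indexed by \<open>E\<close> itself. Repetitions in an indexed family carry no information: compatible
  sections at indices \<open>i\<close>, \<open>j\<close> with \<open>e\<^sub>i = e\<^sub>j\<close> agree, because \<open>D(e\<^sub>i e\<^sub>j) = D(e\<^sub>i)\<close>.\<close>

definition basic_cover :: "('a, 'm) multiring_scheme \<Rightarrow> 'a \<Rightarrow> 'a set \<Rightarrow> bool" where
  "basic_cover A e E \<longleftrightarrow>
    e \<in> carrier A \<and> E \<subseteq> carrier A \<and> basic_open A e = (\<Union>d \<in> E. basic_open A d)"

text \<open>The sections \<open>a\<close>, \<open>b\<close>, \<open>c\<close> range over \<open>A\<^sub>e\<close>, and the conclusion holds in \<open>A\<^sub>e\<close>, which for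
  a general multiring need not be isomorphic to the value \<open>S\<^sub>e\<^sup>-\<^sup>1A\<close> of the presheaf.\<close>

definition monopresheaf :: "('a, 'm) multiring_scheme \<Rightarrow> bool" where
  "monopresheaf A \<longleftrightarrow>
    (\<forall>e E. basic_cover A e E \<longrightarrow>
      (\<forall>a \<in> carrier (localize_at A e). \<forall>b \<in> carrier (localize_at A e).
       \<forall>c \<in> carrier (localize_at A e).
        (\<forall>d \<in> E.
          presheaf_restr A e d (localize_at_to_presheaf A e a)
            \<in> presheaf_restr A e d (localize_at_to_presheaf A e b)
              \<boxplus>\<^bsub>presheaf A d\<^esub> presheaf_restr A e d (localize_at_to_presheaf A e c))
        \<longrightarrow> a \<in> b \<boxplus>\<^bsub>localize_at A e\<^esub> c))"

definition structural_sheaf :: "('a, 'm) multiring_scheme \<Rightarrow> bool" where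
  "structural_sheaf A \<longleftrightarrow>
    monopresheaf A \<and>
    (\<forall>e E x. basic_cover A e E \<and>
        (\<forall>d \<in> E. x d \<in> carrier (presheaf A d)) \<and>
        (\<forall>d \<in> E. \<forall>d' \<in> E.
          presheaf_restr A d (d \<otimes>\<^bsub>A\<^esub> d') (x d) = presheaf_restr A d' (d \<otimes>\<^bsub>A\<^esub> d') (x d'))
      \<longrightarrow> (\<exists>y \<in> carrier (presheaf A e). \<forall>d \<in> E. presheaf_restr A e d y = x d))"

locale mono_multiring = multiring +
  assumes mono: "monopresheaf A"

locale geometric_multiring = multiring +
  assumes sheaf: "structural_sheaf A"

end

theory Submission
  imports Defs
begin

text \<open>In a von Neumann hyperring every element generates the same ideal as an idempotent, and every
  idempotent has an orthogonal complement. Elements given on the pieces of a partition of unity can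
  therefore always be glued, by taking an element of their sum. What fails is uniqueness: the sum of
  the pieces is a set, and a relation \<open>x \<in> y \<boxplus> z\<close> may hold on all pieces without holding
  globally. The set \<open>S_u A\<close> measures this failure. It consists of the elements locally equal to
  \<open>\<one>\<close> (\<open>mem_S_u_iff\<close>), and the Marshall quotient by it imposes exactly those relations
  \<open>a \<in> b \<boxplus> c\<close> that hold locally (\<open>S_u_sum_iff\<close>).

  Locality is formulated with finite families \<open>F\<close> such that only \<open>\<zero>\<close> is annihilated by all of
  \<open>F\<close>. By Zorn's lemma every cover of \<open>D(e)\<close> by basic opens contains a finite family of this
  kind, relative to \<open>e\<close> (\<open>basic_open_compact\<close>), and with idempotents such a family for \<open>\<one>\<close> is refined
  to a partition of unity (\<open>subordinate_partition_of_unity\<close>).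

  In the quotient local relations are global (\<open>S_u_quotient_local\<close>). A von Neumann hyperring with
  this property is geometric: over \<open>D(d)\<close> every section is the class of an element of the ring, a
  relation over \<open>D(d)\<close> is a relation multiplied by \<open>d\<close>, and by compactness the sheaf condition
  reduces to finite gluing.

  For the universal property let \<open>f\<close> be a morphism into a mono-multiring \<open>B\<close>. It maps a local
  relation in \<open>A\<close> to a relation that holds on a cover of the spectrum of \<open>B\<close>, hence to a
  relation in \<open>B\<close>; so \<open>f\<close> factors through the quotient. The factorization is unique because the
  projection is surjective.\<close>

section \<open>Arithmetic in multirings and hyperrings\<close>

context multiring
begin

declare zero_closed [simp] neg_closed [simp]

lemma add_mem_closed:
  "\<lbrakk>x \<in> a \<boxplus> b; a \<in> carrier A; b \<in> carrier A\<rbrakk> \<Longrightarrow> x \<in> carrier A"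
  using add_closed by blast

lemma add_zero_right [simp]: "a \<in> carrier A \<Longrightarrow> a \<boxplus> \<zero> = {a}"
  using add_zero add_mem_closed zero_closed by blast

lemma add_zero_left [simp]: "a \<in> carrier A \<Longrightarrow> \<zero> \<boxplus> a = {a}"
  using add_comm[of \<zero> a] by simp

lemma mult_zero_right [simp]: "a \<in> carrier A \<Longrightarrow> a \<otimes> \<zero> = \<zero>"
  by (rule mult_zero)

lemma mult_zero_left [simp]: "a \<in> carrier A \<Longrightarrow> \<zero> \<otimes> a = \<zero>"
  by (simp add: m_comm[of \<zero> a])

text \<open>Reversibility turns \<open>\<zero> \<in> x \<boxplus> y\<close> into \<open>x = \<boxminus> y\<close>; so it suffices to multiply
  \<open>\<zero> \<in> (\<boxminus> a) \<boxplus> a\<close> by \<open>b\<close>.\<close>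

lemma neg_mult:
  assumes "a \<in> carrier A" "b \<in> carrier A"
  shows "(\<boxminus> a) \<otimes> b = \<boxminus> (a \<otimes> b)"
proof -
  have "\<zero> \<in> (\<boxminus> a) \<boxplus> a"
    using add_reversible[of a a \<zero>] assms by simp
  then have "\<zero> \<otimes> b \<in> ((\<boxminus> a) \<otimes> b) \<boxplus> (a \<otimes> b)"
    using assms by (intro weak_distrib) auto
  then have "\<zero> \<in> ((\<boxminus> a) \<otimes> b) \<boxplus> (a \<otimes> b)" using assms by simp
  then have "(\<boxminus> a) \<otimes> b \<in> \<zero> \<boxplus> (\<boxminus> (a \<otimes> b))"
    using add_reversible[of \<zero> "(\<boxminus> a) \<otimes> b" "a \<otimes> b"] assms
    by (blast intro: m_closed neg_closed zero_closed)
  then show ?thesis using assms by simp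
qed

lemma weak_distrib_left:
  "\<lbrakk>a \<in> carrier A; b \<in> carrier A; c \<in> carrier A; d \<in> carrier A; a \<in> b \<boxplus> c\<rbrakk>
    \<Longrightarrow> d \<otimes> a \<in> (d \<otimes> b) \<boxplus> (d \<otimes> c)"
  using weak_distrib[of a b c d] by (simp add: m_comm)

lemma add_assoc_left:
  assumes "a \<in> carrier A" "b \<in> carrier A" "c \<in> carrier A" "h \<in> b \<boxplus> c" "x \<in> a \<boxplus> h"
  shows "\<exists>g \<in> a \<boxplus> b. x \<in> g \<boxplus> c"
proof -
  have h: "h \<in> carrier A" using assms add_mem_closed by blast
  obtain g where "g \<in> b \<boxplus> a" "x \<in> c \<boxplus> g"
    using add_assoc[of c b a h x] assms h add_comm by auto
  then show ?thesis using assms add_comm add_mem_closed by metis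
qed

text \<open>The hyperaddition form of \<open>(b + c) + (b' + c') = (b + b') + (c + c')\<close>. It lets sums be
  taken termwise along a partition of unity.\<close>

lemma add_interchange:
  assumes carr: "b \<in> carrier A" "c \<in> carrier A" "b' \<in> carrier A" "c' \<in> carrier A"
    and a: "a \<in> b \<boxplus> c" and a': "a' \<in> b' \<boxplus> c'" and x: "x \<in> a \<boxplus> a'"
  shows "\<exists>y \<in> b \<boxplus> b'. \<exists>z \<in> c \<boxplus> c'. x \<in> y \<boxplus> z"
proof -
  have ac: "a \<in> carrier A" "a' \<in> carrier A" using a a' carr add_mem_closed by blast+
  obtain h where h: "h \<in> c \<boxplus> a'" "x \<in> b \<boxplus> h"
    using add_assoc[of b c a' a x] carr ac a x by blast
  have "h \<in> a' \<boxplus> c" using h(1) add_comm carr ac by blast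
  then obtain k where k: "k \<in> c' \<boxplus> c" "h \<in> b' \<boxplus> k"
    using add_assoc[of b' c' c a' h] carr ac a' by blast
  have kc: "k \<in> carrier A" using k(1) carr add_mem_closed by blast
  obtain g where "g \<in> b \<boxplus> b'" "x \<in> g \<boxplus> k"
    using add_assoc_left[of b b' k h x] carr kc k(2) h(2) by blast
  moreover have "k \<in> c \<boxplus> c'" using k(1) add_comm carr by blast
  ultimately show ?thesis by blast
qed

end

section \<open>Ideals and prime ideals\<close>

context multiring
begin

lemma ideal_subset: "multiring_ideal A I \<Longrightarrow> x \<in> I \<Longrightarrow> x \<in> carrier A"
  unfolding multiring_ideal_def by blast

lemma ideal_add: "\<lbrakk>multiring_ideal A I; x \<in> I; y \<in> I; z \<in> x \<boxplus> y\<rbrakk> \<Longrightarrow> z \<in> I"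
  unfolding multiring_ideal_def by blast

lemma ideal_mult: "\<lbrakk>multiring_ideal A I; a \<in> carrier A; x \<in> I\<rbrakk> \<Longrightarrow> a \<otimes> x \<in> I"
  unfolding multiring_ideal_def by blast

lemma ideal_mult_right: "\<lbrakk>multiring_ideal A I; a \<in> carrier A; x \<in> I\<rbrakk> \<Longrightarrow> x \<otimes> a \<in> I"
  using ideal_mult[of I a x] ideal_subset[of I x] m_comm by metis

lemma ideal_zero: "multiring_ideal A I \<Longrightarrow> \<zero> \<in> I"
  using ideal_mult[of I \<zero>] ideal_subset[of I] mult_zero_left
  unfolding multiring_ideal_def by (metis ex_in_conv zero_closed)

lemma idealI:
  assumes "I \<subseteq> carrier A" "\<zero> \<in> I"
    and "\<And>x y z. \<lbrakk>x \<in> I; y \<in> I; z \<in> x \<boxplus> y\<rbrakk> \<Longrightarrow> z \<in> I"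
    and "\<And>a x. \<lbrakk>a \<in> carrier A; x \<in> I\<rbrakk> \<Longrightarrow> a \<otimes> x \<in> I"
  shows "multiring_ideal A I"
  using assms unfolding multiring_ideal_def by blast

text \<open>Primality and the multiplicativity of \<open>S\<^sub>a\<close> are proved with colon ideals instead of sums and
  products of ideals, because weak distributivity alone makes them closed under sums.\<close>

lemma ideal_colon:
  assumes I: "multiring_ideal A I" and a: "a \<in> carrier A"
  shows "multiring_ideal A {x \<in> carrier A. a \<otimes> x \<in> I}"
proof (rule idealI)
  fix x y z assume *: "x \<in> {x \<in> carrier A. a \<otimes> x \<in> I}" "y \<in> {x \<in> carrier A. a \<otimes> x \<in> I}"
    and z: "z \<in> x \<boxplus> y"
  have zc: "z \<in> carrier A" using * z add_mem_closed by blast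
  have "a \<otimes> z \<in> (a \<otimes> x) \<boxplus> (a \<otimes> y)"
    using weak_distrib_left[of z x y a] zc * z a by blast
  then show "z \<in> {x \<in> carrier A. a \<otimes> x \<in> I}"
    using zc * ideal_add[OF I] by blast
next
  fix b x assume *: "b \<in> carrier A" "x \<in> {x \<in> carrier A. a \<otimes> x \<in> I}"
  then have "b \<otimes> (a \<otimes> x) \<in> I" using ideal_mult[OF I] by blast
  then show "b \<otimes> x \<in> {x \<in> carrier A. a \<otimes> x \<in> I}"
    using * a by (simp add: m_lcomm)
qed (use a ideal_zero[OF I] in auto)

lemma principal_ideal_ideal:
  assumes "x \<in> carrier A"
  shows "multiring_ideal A (principal_ideal A x)"
proof (rule idealI)
  have "multiring_ideal A (carrier A)"
    by (rule idealI) (auto intro: add_mem_closed)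
  then show "principal_ideal A x \<subseteq> carrier A"
    using assms unfolding principal_ideal_def by blast
qed (auto simp: principal_ideal_def intro: ideal_zero ideal_add ideal_mult)

lemma principal_ideal_mem: "x \<in> principal_ideal A x"
  unfolding principal_ideal_def by blast

lemma principal_ideal_least:
  "\<lbrakk>multiring_ideal A I; x \<in> I; y \<in> principal_ideal A x\<rbrakk> \<Longrightarrow> y \<in> I"
  unfolding principal_ideal_def by blast

lemma ideal_Union_chain:
  assumes "\<C> \<noteq> {}" and ideals: "\<And>I. I \<in> \<C> \<Longrightarrow> multiring_ideal A I"
    and chain: "\<And>I J. \<lbrakk>I \<in> \<C>; J \<in> \<C>\<rbrakk> \<Longrightarrow> I \<subseteq> J \<or> J \<subseteq> I"
  shows "multiring_ideal A (\<Union>\<C>)"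
proof (rule idealI)
  show "\<Union>\<C> \<subseteq> carrier A" using ideals ideal_subset by blast
  show "\<zero> \<in> \<Union>\<C>" using assms(1) ideals ideal_zero by blast
next
  fix x y z assume "x \<in> \<Union>\<C>" "y \<in> \<Union>\<C>" and z: "z \<in> x \<boxplus> y"
  then obtain I J where "I \<in> \<C>" "x \<in> I" "J \<in> \<C>" "y \<in> J" by blast
  then obtain K where "K \<in> \<C>" "x \<in> K" "y \<in> K" using chain by blast
  then show "z \<in> \<Union>\<C>" using ideals ideal_add z by blast
qed (use ideals ideal_mult in blast)

text \<open>An ideal \<open>P\<close> maximal among those containing \<open>I\<close> but not \<open>e\<close> is prime. If \<open>ab \<in> P\<close> with
  \<open>b \<notin> P\<close>, the colon ideal \<open>(P : a)\<close> is strictly larger than \<open>P\<close>, so it contains \<open>e\<close>, that is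
  \<open>ea \<in> P\<close>. If moreover \<open>a \<notin> P\<close>, the same argument applied to \<open>ea\<close> gives \<open>e\<^sup>2 \<in> P\<close>, hence
  \<open>e \<in> P\<close> by the radicality hypothesis, a contradiction.\<close>

lemma prime_ideal_avoiding:
  assumes I: "multiring_ideal A I" and e: "e \<in> carrier A" "e \<notin> I"
    and radical: "\<And>J. \<lbrakk>multiring_ideal A J; e \<otimes> e \<in> J\<rbrakk> \<Longrightarrow> e \<in> J"
  shows "\<exists>P. multiring_prime_ideal A P \<and> I \<subseteq> P \<and> e \<notin> P"
proof -
  define \<A> where "\<A> = {J. multiring_ideal A J \<and> I \<subseteq> J \<and> e \<notin> J}"
  have "\<exists>P \<in> \<A>. \<forall>J \<in> \<A>. P \<subseteq> J \<longrightarrow> J = P"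
  proof (rule subset_Zorn_nonempty)
    show "\<A> \<noteq> {}" using I e unfolding \<A>_def by blast
  next
    fix \<C> assume "\<C> \<noteq> {}" and c: "subset.chain \<A> \<C>"
    have ca: "\<C> \<subseteq> \<A>" and "\<And>I J. \<lbrakk>I \<in> \<C>; J \<in> \<C>\<rbrakk> \<Longrightarrow> I \<subseteq> J \<or> J \<subseteq> I"
      using c unfolding subset.chain_def by blast+
    then have "multiring_ideal A (\<Union>\<C>)"
      using ideal_Union_chain[of \<C>] \<open>\<C> \<noteq> {}\<close> unfolding \<A>_def by blast
    then show "\<Union>\<C> \<in> \<A>"
      using ca \<open>\<C> \<noteq> {}\<close> unfolding \<A>_def by blast
  qed
  then obtain P where "P \<in> \<A>" and maximal: "\<And>J. \<lbrakk>J \<in> \<A>; P \<subseteq> J\<rbrakk> \<Longrightarrow> J = P" by blast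
  then have P: "multiring_ideal A P" "I \<subseteq> P" "e \<notin> P" unfolding \<A>_def by auto
  have max: "J = P" if "multiring_ideal A J" "P \<subseteq> J" "e \<notin> J" for J
    using maximal[of J] that P(2) unfolding \<A>_def by auto
  have colon: "a \<otimes> e \<in> P"
    if ab: "a \<in> carrier A" "b \<in> carrier A" "a \<otimes> b \<in> P" "b \<notin> P" for a b
  proof (rule ccontr)
    assume "a \<otimes> e \<notin> P"
    then have "{x \<in> carrier A. a \<otimes> x \<in> P} = P"
      using max[OF ideal_colon[OF P(1) ab(1)]] ideal_mult[OF P(1)] ideal_subset[OF P(1)] ab by blast
    then show False using ab by blast
  qed
  have "a \<in> P \<or> b \<in> P" if ab: "a \<in> carrier A" "b \<in> carrier A" "a \<otimes> b \<in> P" for a b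
  proof (rule ccontr)
    assume n: "\<not> (a \<in> P \<or> b \<in> P)"
    have "a \<otimes> e \<in> P" using colon ab n by blast
    then have "e \<otimes> a \<in> P" using m_comm ab e by simp
    then have "e \<otimes> e \<in> P" using colon[of e a] ab e n by blast
    then show False using radical P by blast
  qed
  moreover have "\<one> \<notin> P"
    using ideal_mult[OF P(1), of e \<one>] P(3) e by auto
  ultimately have "multiring_prime_ideal A P"
    using P(1) unfolding multiring_prime_ideal_def by blast
  then show ?thesis using P by blast
qed

lemma prime_ideal_pow:
  assumes P: "multiring_prime_ideal A P" and a: "a \<in> carrier A" and "a [^] (n::nat) \<in> P"
  shows "a \<in> P"
  using assms(3)
proof (induction n)
  case 0
  then show ?case using P unfolding multiring_prime_ideal_def by simp
next
  case (Suc n)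
  then show ?case using P a unfolding multiring_prime_ideal_def
    by (metis nat_pow_Suc nat_pow_closed)
qed

end

lemma vimage_ideal:
  assumes "multiring A" "multiring B" and f: "f \<in> multiring_hom A B" and I: "multiring_ideal B I"
  shows "multiring_ideal A {x \<in> carrier A. f x \<in> I}"
proof -
  interpret A: multiring A by fact
  interpret B: multiring B by fact
  have fc: "\<And>a. a \<in> carrier A \<Longrightarrow> f a \<in> carrier B"
    and add: "\<And>a b c. \<lbrakk>a \<in> carrier A; b \<in> carrier A; c \<in> carrier A; a \<in> b \<boxplus>\<^bsub>A\<^esub> c\<rbrakk> \<Longrightarrow> f a \<in> f b \<boxplus>\<^bsub>B\<^esub> f c"
    and mult: "\<And>a b. \<lbrakk>a \<in> carrier A; b \<in> carrier A\<rbrakk> \<Longrightarrow> f (a \<otimes>\<^bsub>A\<^esub> b) = f a \<otimes>\<^bsub>B\<^esub> f b"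
    and zero: "f \<zero>\<^bsub>A\<^esub> = \<zero>\<^bsub>B\<^esub>"
    using f unfolding multiring_hom_def by auto
  show ?thesis
  proof (rule A.idealI)
    fix x y z assume *: "x \<in> {x \<in> carrier A. f x \<in> I}" "y \<in> {x \<in> carrier A. f x \<in> I}" "z \<in> x \<boxplus>\<^bsub>A\<^esub> y"
    then have "z \<in> carrier A" using A.add_mem_closed by blast
    then show "z \<in> {x \<in> carrier A. f x \<in> I}" using add * B.ideal_add[OF I] by blast
  qed (use zero mult fc B.ideal_zero[OF I] B.ideal_mult[OF I] in auto)
qed

section \<open>Localization\<close>

definition multiplicative :: "('a, 'm) multiring_scheme \<Rightarrow> 'a set \<Rightarrow> bool" where
  "multiplicative A S \<longleftrightarrow> S \<subseteq> carrier A \<and> \<one>\<^bsub>A\<^esub> \<in> S \<and> (\<forall>s \<in> S. \<forall>t \<in> S. s \<otimes>\<^bsub>A\<^esub> t \<in> S)"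

context multiring
begin

text \<open>For closure under products, let \<open>a\<^sup>n \<in> (x)\<close> and \<open>a\<^sup>m \<in> (y)\<close>. The ideal \<open>((xy) : y)\<close> contains
  \<open>x\<close>, hence \<open>a\<^sup>n\<close>; then \<open>((xy) : a\<^sup>n)\<close> contains \<open>y\<close>, hence \<open>a\<^sup>m\<close>.\<close>

lemma S_of_multiplicative:
  assumes a: "a \<in> carrier A"
  shows "multiplicative A (S_of A a)"
  unfolding multiplicative_def
proof (intro conjI ballI)
  show "S_of A a \<subseteq> carrier A" unfolding S_of_def by blast
  show "\<one> \<in> S_of A a" unfolding S_of_def
    using principal_ideal_mem[of \<one>] nat_pow_0[of a] by (metis (mono_tags, lifting) mem_Collect_eq one_closed)
next
  fix x y assume "x \<in> S_of A a" "y \<in> S_of A a"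
  then obtain n m where x: "x \<in> carrier A" "a [^] (n::nat) \<in> principal_ideal A x"
    and y: "y \<in> carrier A" "a [^] (m::nat) \<in> principal_ideal A y"
    unfolding S_of_def by blast
  let ?I = "principal_ideal A (x \<otimes> y)"
  have I: "multiring_ideal A ?I" using principal_ideal_ideal x y by simp
  have "x \<in> {z \<in> carrier A. y \<otimes> z \<in> ?I}"
    using principal_ideal_mem x y m_comm by simp
  then have "y \<otimes> a [^] n \<in> ?I"
    using principal_ideal_least[OF ideal_colon[OF I y(1)] _ x(2)] by blast
  then have "y \<in> {z \<in> carrier A. a [^] n \<otimes> z \<in> ?I}"
    using y a m_comm by simp
  then have "a [^] n \<otimes> a [^] m \<in> ?I"
    using principal_ideal_least[OF ideal_colon[OF I nat_pow_closed[OF a]] _ y(2)] by blast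
  then show "x \<otimes> y \<in> S_of A a"
    unfolding S_of_def using x y a nat_pow_mult by auto
qed

lemma powers_multiplicative: "a \<in> carrier A \<Longrightarrow> multiplicative A (powers A a)"
  unfolding multiplicative_def powers_def
  by (auto simp: nat_pow_mult intro: exI[of _ "0::nat"])

lemma powers_subset_S_of: "a \<in> carrier A \<Longrightarrow> powers A a \<subseteq> S_of A a"
  unfolding powers_def S_of_def using principal_ideal_mem by auto

lemma self_mem_powers: "a \<in> carrier A \<Longrightarrow> a \<in> powers A a"
  unfolding powers_def by (auto intro: exI[of _ "1::nat"])

lemma powers_one: "powers A \<one> = {\<one>}"
  unfolding powers_def by auto

lemma mem_frac: "\<lbrakk>multiplicative A S; a \<in> carrier A; s \<in> S\<rbrakk> \<Longrightarrow> (a, s) \<in> frac A S a s"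
  unfolding frac_def multiplicative_def by auto

lemma frac_eqI:
  assumes S: "multiplicative A S" and a: "a \<in> carrier A" "s \<in> S" and b: "b \<in> carrier A" "t \<in> S"
    and u: "u \<in> S" and eq: "a \<otimes> t \<otimes> u = b \<otimes> s \<otimes> u"
  shows "frac A S a s = frac A S b t"
proof -
  have Sc: "\<And>s. s \<in> S \<Longrightarrow> s \<in> carrier A" and SS: "\<And>s t. \<lbrakk>s \<in> S; t \<in> S\<rbrakk> \<Longrightarrow> s \<otimes> t \<in> S"
    using S unfolding multiplicative_def by blast+
  have *: "frac A S a s \<subseteq> frac A S b t"
    if a: "a \<in> carrier A" "s \<in> S" and b: "b \<in> carrier A" "t \<in> S"
      and eq: "a \<otimes> t \<otimes> u = b \<otimes> s \<otimes> u" for a s b t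
  proof
    fix p assume "p \<in> frac A S a s"
    then obtain c r w where p: "p = (c, r)" and c: "c \<in> carrier A" "r \<in> S" and w: "w \<in> S"
      and eq': "a \<otimes> r \<otimes> w = c \<otimes> s \<otimes> w" unfolding frac_def by blast
    note cl = a b c u w Sc[OF a(2)] Sc[OF b(2)] Sc[OF c(2)] Sc[OF u] Sc[OF w]
    have "b \<otimes> r \<otimes> (s \<otimes> u \<otimes> w) = (b \<otimes> s \<otimes> u) \<otimes> (r \<otimes> w)" using cl by (simp add: m_ac)
    also have "\<dots> = (a \<otimes> t \<otimes> u) \<otimes> (r \<otimes> w)" using eq by simp
    also have "\<dots> = (a \<otimes> r \<otimes> w) \<otimes> (t \<otimes> u)" using cl by (simp add: m_ac)
    also have "\<dots> = (c \<otimes> s \<otimes> w) \<otimes> (t \<otimes> u)" using eq' by simp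
    also have "\<dots> = c \<otimes> t \<otimes> (s \<otimes> u \<otimes> w)" using cl by (simp add: m_ac)
    finally have "b \<otimes> r \<otimes> (s \<otimes> u \<otimes> w) = c \<otimes> t \<otimes> (s \<otimes> u \<otimes> w)" .
    moreover have "s \<otimes> u \<otimes> w \<in> S" using SS a u w by blast
    ultimately show "p \<in> frac A S b t" unfolding frac_def p using c by blast
  qed
  show ?thesis
    using *[OF a b eq] *[OF b a eq[symmetric]] by blast
qed

lemma frac_eqD:
  assumes "multiplicative A S" "b \<in> carrier A" "t \<in> S" "frac A S a s = frac A S b t"
  shows "\<exists>u \<in> S. a \<otimes> t \<otimes> u = b \<otimes> s \<otimes> u"
  using mem_frac[OF assms(1-3)] unfolding assms(4)[symmetric] unfolding frac_def by blast

lemma frac_closed: "\<lbrakk>a \<in> carrier A; s \<in> S\<rbrakk> \<Longrightarrow> frac A S a s \<in> carrier (localization A S)"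
  unfolding localization_def by auto

lemma localization_cases:
  assumes "X \<in> carrier (localization A S)"
  obtains a s where "a \<in> carrier A" "s \<in> S" "X = frac A S a s"
  using assms unfolding localization_def by auto

lemma localization_map_frac:
  assumes S: "multiplicative A S" and T: "multiplicative A T" and "S \<subseteq> T"
    and a: "a \<in> carrier A" "s \<in> S"
  shows "localization_map A S T (frac A S a s) = frac A T a s"
proof -
  have "frac A T b t = frac A T a s" if "(b, t) \<in> frac A S a s" for b t
  proof -
    from that obtain u where "u \<in> S" "b \<in> carrier A" "t \<in> S" "a \<otimes> t \<otimes> u = b \<otimes> s \<otimes> u"
      unfolding frac_def by blast
    then show ?thesis
      using frac_eqI[OF T, of b t a s u] a \<open>S \<subseteq> T\<close> by fastforce
  qed
  then have "(\<Union>(b, t) \<in> frac A S a s. frac A T b t) = frac A T a s"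
    using mem_frac[OF S a] by blast
  then show ?thesis
    unfolding localization_map_def using frac_closed[OF a] by simp
qed

lemma localization_addI:
  assumes "multiplicative A S" "a \<in> carrier A" "b \<in> carrier A" "c \<in> carrier A"
    and "s \<in> S" "t \<in> S" "u \<in> S" "v \<in> S"
    and "a \<otimes> t \<otimes> u \<otimes> v \<in> (b \<otimes> s \<otimes> u \<otimes> v) \<boxplus> (c \<otimes> s \<otimes> t \<otimes> v)"
  shows "frac A S a s \<in> frac A S b t \<boxplus>\<^bsub>localization A S\<^esub> frac A S c u"
proof -
  have "(a, s) \<in> frac A S a s" "(b, t) \<in> frac A S b t" "(c, u) \<in> frac A S c u"
    using mem_frac assms by blast+
  then show ?thesis unfolding localization_def using assms by fastforce
qed

text \<open>Membership in a sum of fractions that is witnessed by some representatives is witnessed by any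
  others after enlarging the common denominator \<open>v\<close>.\<close>

lemma localization_addD:
  assumes S: "multiplicative A S"
    and carr: "a \<in> carrier A" "b \<in> carrier A" "c \<in> carrier A" "s \<in> S" "t \<in> S" "u \<in> S"
    and sum: "frac A S a s \<in> frac A S b t \<boxplus>\<^bsub>localization A S\<^esub> frac A S c u"
  shows "\<exists>v \<in> S. a \<otimes> t \<otimes> u \<otimes> v \<in> (b \<otimes> s \<otimes> u \<otimes> v) \<boxplus> (c \<otimes> s \<otimes> t \<otimes> v)"
proof -
  have Sc: "\<And>s. s \<in> S \<Longrightarrow> s \<in> carrier A" and SS: "\<And>s t. \<lbrakk>s \<in> S; t \<in> S\<rbrakk> \<Longrightarrow> s \<otimes> t \<in> S"
    using S unfolding multiplicative_def by blast+
  obtain a' s' b' t' c' u' v where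
    mem: "(a', s') \<in> frac A S a s" "(b', t') \<in> frac A S b t" "(c', u') \<in> frac A S c u"
    and v: "v \<in> S"
    and *: "a' \<otimes> t' \<otimes> u' \<otimes> v \<in> (b' \<otimes> s' \<otimes> u' \<otimes> v) \<boxplus> (c' \<otimes> s' \<otimes> t' \<otimes> v)"
    using sum unfolding localization_def by auto
  obtain w1 w2 w3 where w: "w1 \<in> S" "w2 \<in> S" "w3 \<in> S"
    and eqs: "a \<otimes> s' \<otimes> w1 = a' \<otimes> s \<otimes> w1" "b \<otimes> t' \<otimes> w2 = b' \<otimes> t \<otimes> w2" "c \<otimes> u' \<otimes> w3 = c' \<otimes> u \<otimes> w3"
    and c': "a' \<in> carrier A" "b' \<in> carrier A" "c' \<in> carrier A" "s' \<in> S" "t' \<in> S" "u' \<in> S"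
    using mem unfolding frac_def by blast
  note cl = carr c' w v carr(4-6)[THEN Sc] c'(4-6)[THEN Sc] w[THEN Sc] v[THEN Sc]
  \<comment> \<open>Multiplying by \<open>?d\<close> creates the factors \<open>s w\<^sub>1\<close>, \<open>t w\<^sub>2\<close>, \<open>u w\<^sub>3\<close> through which the three
    numerators are exchanged; the leftover factors are collected in \<open>?V\<close>.\<close>
  let ?d = "s \<otimes> t \<otimes> u \<otimes> w1 \<otimes> w2 \<otimes> w3"
  let ?V = "s' \<otimes> t' \<otimes> u' \<otimes> v \<otimes> w1 \<otimes> w2 \<otimes> w3"
  have "(a' \<otimes> t' \<otimes> u' \<otimes> v) \<otimes> ?d \<in> ((b' \<otimes> s' \<otimes> u' \<otimes> v) \<otimes> ?d) \<boxplus> ((c' \<otimes> s' \<otimes> t' \<otimes> v) \<otimes> ?d)"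
    by (rule weak_distrib[OF _ _ _ _ *]) (use cl in auto)
  moreover have "(a' \<otimes> t' \<otimes> u' \<otimes> v) \<otimes> ?d = a \<otimes> t \<otimes> u \<otimes> ?V"
  proof -
    have "(a' \<otimes> t' \<otimes> u' \<otimes> v) \<otimes> ?d = (a' \<otimes> s \<otimes> w1) \<otimes> (t \<otimes> u \<otimes> t' \<otimes> u' \<otimes> v \<otimes> w2 \<otimes> w3)"
      using cl by (simp add: m_ac)
    also have "\<dots> = (a \<otimes> s' \<otimes> w1) \<otimes> (t \<otimes> u \<otimes> t' \<otimes> u' \<otimes> v \<otimes> w2 \<otimes> w3)"
      by (simp only: eqs(1))
    also have "\<dots> = a \<otimes> t \<otimes> u \<otimes> ?V"
      using cl by (simp add: m_ac)
    finally show ?thesis .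
  qed
  moreover have "(b' \<otimes> s' \<otimes> u' \<otimes> v) \<otimes> ?d = b \<otimes> s \<otimes> u \<otimes> ?V"
  proof -
    have "(b' \<otimes> s' \<otimes> u' \<otimes> v) \<otimes> ?d = (b' \<otimes> t \<otimes> w2) \<otimes> (s \<otimes> u \<otimes> s' \<otimes> u' \<otimes> v \<otimes> w1 \<otimes> w3)"
      using cl by (simp add: m_ac)
    also have "\<dots> = (b \<otimes> t' \<otimes> w2) \<otimes> (s \<otimes> u \<otimes> s' \<otimes> u' \<otimes> v \<otimes> w1 \<otimes> w3)"
      by (simp only: eqs(2))
    also have "\<dots> = b \<otimes> s \<otimes> u \<otimes> ?V"
      using cl by (simp add: m_ac)
    finally show ?thesis .
  qed
  moreover have "(c' \<otimes> s' \<otimes> t' \<otimes> v) \<otimes> ?d = c \<otimes> s \<otimes> t \<otimes> ?V"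
  proof -
    have "(c' \<otimes> s' \<otimes> t' \<otimes> v) \<otimes> ?d = (c' \<otimes> u \<otimes> w3) \<otimes> (s \<otimes> t \<otimes> s' \<otimes> t' \<otimes> v \<otimes> w1 \<otimes> w2)"
      using cl by (simp add: m_ac)
    also have "\<dots> = (c \<otimes> u' \<otimes> w3) \<otimes> (s \<otimes> t \<otimes> s' \<otimes> t' \<otimes> v \<otimes> w1 \<otimes> w2)"
      by (simp only: eqs(3))
    also have "\<dots> = c \<otimes> s \<otimes> t \<otimes> ?V"
      using cl by (simp add: m_ac)
    finally show ?thesis .
  qed
  ultimately have "a \<otimes> t \<otimes> u \<otimes> ?V \<in> (b \<otimes> s \<otimes> u \<otimes> ?V) \<boxplus> (c \<otimes> s \<otimes> t \<otimes> ?V)"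
    by (simp only:)
  moreover have "?V \<in> S" by (intro SS c' w v)
  ultimately show ?thesis by blast
qed

end

section \<open>Finite covers\<close>

text \<open>A family \<open>F\<close> covers \<open>e\<close> when whatever vanishes on \<open>F\<close> vanishes on \<open>e\<close>. In a von Neumann
  hyperring this says that \<open>D(e)\<close> is contained in the union of the \<open>D(f)\<close> with \<open>f \<in> F\<close>. Stated
  through annihilators, covers can be refined and multiplied in any multiring, with no orthogonality
  to maintain.\<close>

definition finite_cover :: "('a, 'm) multiring_scheme \<Rightarrow> 'a \<Rightarrow> 'a set \<Rightarrow> bool" where
  "finite_cover A e F \<longleftrightarrow> finite F \<and> F \<subseteq> carrier A \<and>
    (\<forall>y \<in> carrier A. (\<forall>f \<in> F. y \<otimes>\<^bsub>A\<^esub> f = \<zero>\<^bsub>A\<^esub>) \<longrightarrow> y \<otimes>\<^bsub>A\<^esub> e = \<zero>\<^bsub>A\<^esub>)"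

context multiring
begin

lemma finite_coverD:
  "\<lbrakk>finite_cover A e F; y \<in> carrier A; \<And>f. f \<in> F \<Longrightarrow> y \<otimes> f = \<zero>\<rbrakk> \<Longrightarrow> y \<otimes> e = \<zero>"
  unfolding finite_cover_def by blast

lemma finite_cover_carrier: "finite_cover A e F \<Longrightarrow> f \<in> F \<Longrightarrow> f \<in> carrier A"
  unfolding finite_cover_def by blast

lemma finite_cover_self: "e \<in> carrier A \<Longrightarrow> finite_cover A e {e}"
  unfolding finite_cover_def by simp

lemma finite_cover_UN:
  assumes F: "finite_cover A \<one> F" and G: "\<And>f. f \<in> F \<Longrightarrow> finite_cover A \<one> (G f)"
  shows "finite_cover A \<one> (\<Union>f \<in> F. (\<lambda>g. f \<otimes> g) ` G f)"
  unfolding finite_cover_def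
proof (intro conjI ballI impI)
  have Fc: "\<And>f. f \<in> F \<Longrightarrow> f \<in> carrier A" using F finite_cover_carrier by blast
  have Gc: "\<And>f g. \<lbrakk>f \<in> F; g \<in> G f\<rbrakk> \<Longrightarrow> g \<in> carrier A" using G finite_cover_carrier by blast
  show "finite (\<Union>f \<in> F. (\<lambda>g. f \<otimes> g) ` G f)"
    using F G unfolding finite_cover_def by blast
  show "(\<Union>f \<in> F. (\<lambda>g. f \<otimes> g) ` G f) \<subseteq> carrier A"
    using Fc Gc by auto
  fix y assume y: "y \<in> carrier A"
    and 0: "\<forall>x \<in> (\<Union>f \<in> F. (\<lambda>g. f \<otimes> g) ` G f). y \<otimes> x = \<zero>"
  show "y \<otimes> \<one> = \<zero>"
  proof (rule finite_coverD[OF F y])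
    fix f assume f: "f \<in> F"
    have "(y \<otimes> f) \<otimes> \<one> = \<zero>"
      by (rule finite_coverD[OF G[OF f]]) (use 0 y f Fc Gc in \<open>auto simp: m_assoc\<close>)
    then show "y \<otimes> f = \<zero>" using y Fc[OF f] by simp
  qed
qed

lemma finite_cover_mult:
  assumes "finite_cover A \<one> F" "finite_cover A \<one> G"
  shows "finite_cover A \<one> ((\<lambda>(f, g). f \<otimes> g) ` (F \<times> G))"
proof -
  have "(\<lambda>(f, g). f \<otimes> g) ` (F \<times> G) = (\<Union>f \<in> F. (\<lambda>g. f \<otimes> g) ` G)" by auto
  then show ?thesis using finite_cover_UN[of F "\<lambda>_. G"] assms by simp
qed

text \<open>This ideal contains \<open>X\<close>, so a prime ideal above it lies outside every \<open>D(x)\<close> with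
  \<open>x \<in> X\<close>. Compactness of basic opens amounts to this observation.\<close>

lemma ideal_finitely_covered:
  assumes X: "X \<subseteq> carrier A"
  shows "multiring_ideal A {x \<in> carrier A. \<exists>F \<subseteq> X. finite_cover A x F}"
proof (rule idealI)
  show "\<zero> \<in> {x \<in> carrier A. \<exists>F \<subseteq> X. finite_cover A x F}"
    by (auto simp: finite_cover_def intro: exI[of _ "{}"])
next
  fix x x' z
  assume "x \<in> {x \<in> carrier A. \<exists>F \<subseteq> X. finite_cover A x F}"
    and "x' \<in> {x \<in> carrier A. \<exists>F \<subseteq> X. finite_cover A x F}" and z: "z \<in> x \<boxplus> x'"
  then obtain F F' where x: "x \<in> carrier A" "F \<subseteq> X" "finite_cover A x F"
    and x': "x' \<in> carrier A" "F' \<subseteq> X" "finite_cover A x' F'" by blast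
  have zc: "z \<in> carrier A" using add_mem_closed[OF z] x x' by blast
  have "finite_cover A z (F \<union> F')"
    unfolding finite_cover_def
  proof (intro conjI ballI impI)
    fix y assume y: "y \<in> carrier A" and 0: "\<forall>f \<in> F \<union> F'. y \<otimes> f = \<zero>"
    have "y \<otimes> x = \<zero>" "y \<otimes> x' = \<zero>"
      using finite_coverD[OF x(3) y] finite_coverD[OF x'(3) y] 0 by blast+
    then show "y \<otimes> z = \<zero>"
      using weak_distrib_left[OF zc x(1) x'(1) y z] by simp
  qed (use x x' in \<open>auto simp: finite_cover_def\<close>)
  then show "z \<in> {x \<in> carrier A. \<exists>F \<subseteq> X. finite_cover A x F}"
    using zc x(2) x'(2) by (intro CollectI conjI exI[of _ "F \<union> F'"]) auto
next
  fix a x assume a: "a \<in> carrier A" and "x \<in> {x \<in> carrier A. \<exists>F \<subseteq> X. finite_cover A x F}"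
  then obtain F where x: "x \<in> carrier A" "F \<subseteq> X" "finite_cover A x F" by blast
  have "finite_cover A (a \<otimes> x) F"
    using x a unfolding finite_cover_def by (metis m_lcomm mult_zero)
  then show "a \<otimes> x \<in> {x \<in> carrier A. \<exists>F \<subseteq> X. finite_cover A x F}"
    using a x by blast
qed blast

end

section \<open>Iterated sums\<close>

context multiring
begin

lemma hsum_Nil [simp]: "hsum A [] = {\<zero>}"
  by (simp add: hsum_def)

lemma hsum_Cons [simp]: "hsum A (e # es) = (\<Union>x \<in> hsum A es. e \<boxplus> x)"
  by (simp add: hsum_def)

lemma hsum_subset_ideal:
  assumes "multiring_ideal A I" "set es \<subseteq> I"
  shows "hsum A es \<subseteq> I"
  using assms(2)
proof (induction es)
  case Nil
  then show ?case using ideal_zero assms(1) by simp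
next
  case (Cons e es)
  then have "e \<in> I" "hsum A es \<subseteq> I" by auto
  then show ?case using ideal_add[OF assms(1)] by auto
qed

lemma hsum_closed:
  "\<lbrakk>x \<in> hsum A es; set es \<subseteq> carrier A\<rbrakk> \<Longrightarrow> x \<in> carrier A"
  by (induction es arbitrary: x) (auto dest: add_mem_closed)

lemma hsum_mult:
  assumes y: "y \<in> carrier A" and "set es \<subseteq> carrier A" "x \<in> hsum A es"
  shows "y \<otimes> x \<in> hsum A (map (\<lambda>e. y \<otimes> e) es)"
  using assms(2,3)
proof (induction es arbitrary: x)
  case Nil
  then show ?case using y by simp
next
  case (Cons e es)
  then obtain x' where x': "x' \<in> hsum A es" "x \<in> e \<boxplus> x'" by auto
  have c: "x' \<in> carrier A" "e \<in> carrier A" "x \<in> carrier A"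
    using hsum_closed[OF x'(1)] x'(2) Cons.prems add_mem_closed by auto
  have "y \<otimes> x \<in> (y \<otimes> e) \<boxplus> (y \<otimes> x')" using weak_distrib_left c y x'(2) by blast
  then show ?case using Cons.IH[OF _ x'(1)] Cons.prems by auto
qed

lemma hsum_all_zero: "set es \<subseteq> {\<zero>} \<Longrightarrow> hsum A es = {\<zero>}"
  by (induction es) auto

lemma mult_hsum_eq_zero:
  assumes "y \<in> carrier A" "set es \<subseteq> carrier A" "x \<in> hsum A es"
    and "\<And>e. e \<in> set es \<Longrightarrow> y \<otimes> e = \<zero>"
  shows "y \<otimes> x = \<zero>"
  using hsum_mult[OF assms(1-3)] hsum_all_zero[of "map (\<lambda>e. y \<otimes> e) es"] assms(4) by auto

lemma hsum_add:
  assumes "p \<in> carrier A" "q \<in> carrier A" "r \<in> carrier A"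
    and "set es \<subseteq> carrier A" and "\<And>e. e \<in> set es \<Longrightarrow> p \<otimes> e \<in> (q \<otimes> e) \<boxplus> (r \<otimes> e)"
    and "x \<in> hsum A (map (\<lambda>e. p \<otimes> e) es)"
  shows "\<exists>y \<in> hsum A (map (\<lambda>e. q \<otimes> e) es). \<exists>z \<in> hsum A (map (\<lambda>e. r \<otimes> e) es). x \<in> y \<boxplus> z"
  using assms(4-6)
proof (induction es arbitrary: x)
  case Nil
  then show ?case by simp
next
  case (Cons e es)
  obtain x' where x': "x' \<in> hsum A (map (\<lambda>e. p \<otimes> e) es)" "x \<in> (p \<otimes> e) \<boxplus> x'"
    using Cons.prems by auto
  then obtain y' z' where yz: "y' \<in> hsum A (map (\<lambda>e. q \<otimes> e) es)"
    "z' \<in> hsum A (map (\<lambda>e. r \<otimes> e) es)" "x' \<in> y' \<boxplus> z'"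
    using Cons.IH[of x'] Cons.prems by auto
  have c: "e \<in> carrier A" using Cons.prems by simp
  have "y' \<in> carrier A" "z' \<in> carrier A"
    using hsum_closed[OF yz(1)] hsum_closed[OF yz(2)] Cons.prems assms(1-3) by (auto simp: image_subset_iff subset_iff)
  then obtain y z where "y \<in> (q \<otimes> e) \<boxplus> y'" "z \<in> (r \<otimes> e) \<boxplus> z'" "x \<in> y \<boxplus> z"
    using add_interchange[of "q \<otimes> e" "r \<otimes> e" y' z' "p \<otimes> e" x' x] x'(2) yz c Cons.prems assms
    by auto
  then show ?case using yz by auto
qed

text \<open>Multiplication by \<open>e\<close> kills every summand but \<open>e\<close> itself: an element of \<open>e\<^sub>1 \<boxplus> \<dots> \<boxplus> e\<^sub>n\<close>
  looks like \<open>\<one>\<close> on each \<open>e\<^sub>i\<close>.\<close>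

lemma hsum_orthogonal:
  assumes "set es \<subseteq> carrier A" "\<And>e. e \<in> set es \<Longrightarrow> e \<otimes> e = e"
    and "sorted_wrt (\<lambda>x y. x \<otimes> y = \<zero>) es" "s \<in> hsum A es" "e \<in> set es"
  shows "s \<otimes> e = e"
  using assms
proof (induction es arbitrary: s)
  case Nil
  then show ?case by simp
next
  case (Cons a es)
  obtain x where x: "x \<in> hsum A es" "s \<in> a \<boxplus> x" using Cons.prems by auto
  have c: "a \<in> carrier A" "x \<in> carrier A" "e \<in> carrier A" "s \<in> carrier A"
    using hsum_closed[OF x(1)] x(2) add_mem_closed Cons.prems by auto
  have *: "s \<otimes> e \<in> (a \<otimes> e) \<boxplus> (x \<otimes> e)"
    using weak_distrib c x(2) by blast
  show ?case
  proof (cases "e \<in> set es")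
    case True
    then have "x \<otimes> e = e" using Cons.IH[OF _ _ _ x(1)] Cons.prems by auto
    moreover have "a \<otimes> e = \<zero>" using True Cons.prems(3) by auto
    ultimately show ?thesis using * c by simp
  next
    case False
    then have "e = a" using Cons.prems(5) by simp
    moreover have "a \<otimes> x = \<zero>"
      by (rule mult_hsum_eq_zero[OF c(1) _ x(1)]) (use Cons.prems in auto)
    ultimately show ?thesis using * c Cons.prems(2) by (simp add: m_comm)
  qed
qed

text \<open>Orthogonality of earlier entries with later ones suffices by commutativity, and it has the
  recursive form that inductions on lists use.\<close>

lemma partition_of_unity_iff:
  "partition_of_unity A es \<longleftrightarrow> set es \<subseteq> carrier A \<and> (\<forall>e \<in> set es. e \<otimes> e = e) \<and>
    sorted_wrt (\<lambda>x y. x \<otimes> y = \<zero>) es \<and> \<one> \<in> hsum A es"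
proof -
  have "(\<forall>i < length es. \<forall>j < length es. i \<noteq> j \<longrightarrow> es ! i \<otimes> es ! j = \<zero>)
      \<longleftrightarrow> sorted_wrt (\<lambda>x y. x \<otimes> y = \<zero>) es" if c: "set es \<subseteq> carrier A"
  proof
    assume s: "sorted_wrt (\<lambda>x y. x \<otimes> y = \<zero>) es"
    show "\<forall>i < length es. \<forall>j < length es. i \<noteq> j \<longrightarrow> es ! i \<otimes> es ! j = \<zero>"
    proof (intro allI impI)
      fix i j assume ij: "i < length es" "j < length es" "i \<noteq> j"
      then have "es ! i \<in> carrier A" "es ! j \<in> carrier A" using c by auto
      then show "es ! i \<otimes> es ! j = \<zero>"
        using s ij m_comm unfolding sorted_wrt_iff_nth_less by (metis nat_neq_iff)
    qed
  qed (auto simp: sorted_wrt_iff_nth_less)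
  then show ?thesis unfolding partition_of_unity_def by blast
qed

end

text \<open>Strong distributivity allows a common factor to be taken out of an iterated sum. This is
  what makes local coincidence of \<open>a\<close> and \<open>b\<close> visible as \<open>a = b t\<close> with \<open>t\<close> in a sum of idempotents.\<close>

lemma (in hyperring) hsum_mult_converse:
  assumes y: "y \<in> carrier A" and "set es \<subseteq> carrier A" "x \<in> hsum A (map (\<lambda>e. y \<otimes> e) es)"
  shows "\<exists>t \<in> hsum A es. x = y \<otimes> t"
  using assms(2,3)
proof (induction es arbitrary: x)
  case Nil
  then show ?case using y by simp
next
  case (Cons e es)
  obtain x' where x': "x' \<in> hsum A (map (\<lambda>e. y \<otimes> e) es)" "x \<in> (y \<otimes> e) \<boxplus> x'"
    using Cons.prems by auto
  then obtain t where t: "t \<in> hsum A es" "x' = y \<otimes> t" using Cons by auto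
  have c: "t \<in> carrier A" "e \<in> carrier A" using hsum_closed[OF t(1)] Cons.prems by auto
  have "x \<in> (e \<otimes> y) \<boxplus> (t \<otimes> y)" using x'(2) t(2) c y m_comm by simp
  then obtain s where s: "s \<in> e \<boxplus> t" "x = s \<otimes> y" using strong_distrib[of e t y x] c y by blast
  then have "x = y \<otimes> s" using m_comm y c add_mem_closed by metis
  then show ?case using s(1) t(1) by auto
qed

section \<open>Idempotents and compactness in von Neumann hyperrings\<close>

lemma (in hyperring) principal_ideal_multiples:
  assumes x: "x \<in> carrier A" and y: "y \<in> principal_ideal A x"
  shows "\<exists>w \<in> carrier A. y = x \<otimes> w"
proof -
  have "multiring_ideal A {x \<otimes> w |w. w \<in> carrier A}"
  proof (rule idealI)
    show "\<zero> \<in> {x \<otimes> w |w. w \<in> carrier A}" using x by (auto intro: exI[of _ \<zero>])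
  next
    fix p q r assume "p \<in> {x \<otimes> w |w. w \<in> carrier A}" "q \<in> {x \<otimes> w |w. w \<in> carrier A}"
      and r: "r \<in> p \<boxplus> q"
    then obtain w v where w: "w \<in> carrier A" "p = x \<otimes> w" and v: "v \<in> carrier A" "q = x \<otimes> v"
      by blast
    have "r \<in> (w \<otimes> x) \<boxplus> (v \<otimes> x)" using r w v x m_comm by simp
    then obtain u where "u \<in> w \<boxplus> v" "r = u \<otimes> x" using strong_distrib[of w v x r] w v x by blast
    then show "r \<in> {x \<otimes> w |w. w \<in> carrier A}" using add_mem_closed w v x m_comm by blast
  next
    fix a p assume "a \<in> carrier A" "p \<in> {x \<otimes> w |w. w \<in> carrier A}"
    then show "a \<otimes> p \<in> {x \<otimes> w |w. w \<in> carrier A}" using x m_lcomm m_closed by blast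
  qed (use x in auto)
  moreover have "x \<in> {x \<otimes> w |w. w \<in> carrier A}" using x by (auto intro: exI[of _ \<one>])
  ultimately show ?thesis using principal_ideal_least y by blast
qed

context von_neumann_hyperring
begin

lemma quasi_inverse:
  assumes "a \<in> carrier A"
  obtains k where "k \<in> carrier A" "a \<otimes> a \<otimes> k = a"
  using von_neumann_regular[OF assms] by metis

text \<open>The idempotent \<open>e = ak\<close> generates the same ideal as \<open>a\<close>, so it has the same open set.\<close>

lemma support_idempotent:
  assumes a: "a \<in> carrier A"
  obtains e k where "k \<in> carrier A" "e \<in> carrier A" "e \<otimes> e = e" "a \<otimes> k = e" "a \<otimes> e = a"
proof -
  obtain k where k: "k \<in> carrier A" "a \<otimes> a \<otimes> k = a" using quasi_inverse[OF a] by blast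
  have "(a \<otimes> k) \<otimes> (a \<otimes> k) = (a \<otimes> a \<otimes> k) \<otimes> k" using a k(1) by (simp add: m_ac)
  then show ?thesis using that[of k "a \<otimes> k"] k a by (simp add: m_assoc)
qed

text \<open>There is no subtraction to define \<open>\<one> - e\<close>, and an element of \<open>\<one> \<boxplus> (\<boxminus> e)\<close> need not be
  orthogonal to \<open>e\<close>. But \<open>\<zero> \<in> e \<boxplus> (\<boxminus> e) = \<one> e \<boxplus> (\<boxminus> e) e\<close>, and strong distributivity extracts some
  \<open>g \<in> \<one> \<boxplus> (\<boxminus> e)\<close> with \<open>g e = \<zero>\<close>; multiplying \<open>\<one> \<in> g \<boxplus> e\<close> by \<open>g\<close> shows that \<open>g\<close> is idempotent.\<close>

lemma complement_idempotent:
  assumes e: "e \<in> carrier A" "e \<otimes> e = e"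
  obtains g where "g \<in> carrier A" "g \<otimes> g = g" "e \<otimes> g = \<zero>" "\<one> \<in> g \<boxplus> e"
proof -
  have "\<zero> \<in> e \<boxplus> (\<boxminus> e)"
    using add_reversible[of e \<zero> e] e by simp
  then have "\<zero> \<in> (\<one> \<otimes> e) \<boxplus> ((\<boxminus> e) \<otimes> e)"
    using e neg_mult[of e e] by simp
  then obtain g where g: "g \<in> \<one> \<boxplus> (\<boxminus> e)" "\<zero> = g \<otimes> e"
    using strong_distrib[OF one_closed neg_closed[OF e(1)] e(1)] by blast
  have gc: "g \<in> carrier A" using add_mem_closed[OF g(1)] e by simp
  have ge: "e \<otimes> g = \<zero>" using g(2) gc e m_comm by simp
  have "g \<in> (\<boxminus> e) \<boxplus> \<one>" using g(1) add_comm e by simp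
  then have "\<one> \<in> \<boxminus> (\<boxminus> e) \<boxplus> g"
    using add_reversible[of g "\<boxminus> e" \<one>] gc e by simp
  moreover have "\<boxminus> (\<boxminus> e) = e"
    using add_reversible[of \<zero> e "\<boxminus> e"] \<open>\<zero> \<in> e \<boxplus> (\<boxminus> e)\<close> e by simp
  ultimately have 1: "\<one> \<in> g \<boxplus> e" using add_comm gc e by simp
  have "\<one> \<otimes> g \<in> (g \<otimes> g) \<boxplus> (e \<otimes> g)"
    using weak_distrib[OF _ _ _ _ 1] gc e by simp
  then have "g \<otimes> g = g" using gc ge by simp
  then show ?thesis using that gc ge 1 by blast
qed

lemma power_factor:
  assumes d: "d \<in> carrier A"
  shows "\<exists>w \<in> carrier A. d = d [^] (n::nat) \<otimes> w"
proof (induction n)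
  case 0
  then show ?case using d by auto
next
  case (Suc n)
  then obtain w where w: "w \<in> carrier A" "d = d [^] n \<otimes> w" by blast
  obtain k where k: "k \<in> carrier A" "d \<otimes> d \<otimes> k = d" using quasi_inverse[OF d] by blast
  have "d [^] Suc n \<otimes> (w \<otimes> k) = (d [^] n \<otimes> w) \<otimes> d \<otimes> k"
    using d w(1) k(1) by (simp add: m_ac)
  also have "\<dots> = d" using w(2) k(2) by simp
  finally show ?case using w(1) k(1) by (metis m_closed)
qed

text \<open>An element that is invertible on \<open>D(d)\<close> divides \<open>d\<close> itself, because \<open>d\<close> is a multiple of each of its
  powers. Relations in \<open>S\<^sub>d\<^sup>-\<^sup>1A\<close> are therefore relations in \<open>A\<close> multiplied by \<open>d\<close>.\<close>

lemma S_of_factor: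
  assumes d: "d \<in> carrier A" and x: "x \<in> S_of A d"
  shows "\<exists>w \<in> carrier A. d = x \<otimes> w"
proof -
  obtain n where xc: "x \<in> carrier A" and "d [^] (n::nat) \<in> principal_ideal A x"
    using x unfolding S_of_def by blast
  then obtain v where v: "v \<in> carrier A" "d [^] n = x \<otimes> v"
    using principal_ideal_multiples by blast
  obtain w where w: "w \<in> carrier A" "d = d [^] n \<otimes> w" using power_factor[OF d] by blast
  have "d = x \<otimes> (v \<otimes> w)" using w v xc m_assoc by metis
  then show ?thesis using v w by blast
qed

lemma ideal_radical:
  assumes "multiring_ideal A I" "d \<in> carrier A" "d \<otimes> d \<in> I"
  shows "d \<in> I"
  using quasi_inverse[OF assms(2)] ideal_mult_right[OF assms(1) _ assms(3)] by metis

lemma basic_open_compact: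
  assumes d: "d \<in> carrier A" and X: "X \<subseteq> carrier A"
    and cov: "basic_open A d \<subseteq> (\<Union>x \<in> X. basic_open A x)"
  shows "\<exists>F \<subseteq> X. finite_cover A d F"
proof (rule ccontr)
  assume n: "\<not> (\<exists>F \<subseteq> X. finite_cover A d F)"
  let ?I = "{x \<in> carrier A. \<exists>F \<subseteq> X. finite_cover A x F}"
  obtain P where P: "multiring_prime_ideal A P" "?I \<subseteq> P" "d \<notin> P"
    using prime_ideal_avoiding[OF ideal_finitely_covered[OF X] d] n ideal_radical[OF _ d] by blast
  have "X \<subseteq> ?I" using X finite_cover_self by blast
  moreover obtain x where "x \<in> X" "x \<notin> P"
    using P cov unfolding basic_open_def multiring_spec_def by blast
  ultimately show False using P(2) by blast
qed

text \<open>Otherwise a prime ideal containing \<open>(x)\<close> but not \<open>d\<close> would lie in \<open>D(d)\<close> and contain a power of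
  \<open>e\<close>. With this lemma the restriction maps of the presheaf make sense.\<close>

lemma S_of_antimono:
  assumes d: "d \<in> carrier A" and e: "e \<in> carrier A" and sub: "basic_open A d \<subseteq> basic_open A e"
  shows "S_of A e \<subseteq> S_of A d"
proof
  fix x assume "x \<in> S_of A e"
  then obtain n where x: "x \<in> carrier A" "e [^] (n::nat) \<in> principal_ideal A x"
    unfolding S_of_def by blast
  have "d \<in> principal_ideal A x"
  proof (rule ccontr)
    assume n: "d \<notin> principal_ideal A x"
    then obtain P where P: "multiring_prime_ideal A P" "principal_ideal A x \<subseteq> P" "d \<notin> P"
      using prime_ideal_avoiding[OF principal_ideal_ideal[OF x(1)] d n] ideal_radical[OF _ d] by blast
    then have "e \<in> P" using prime_ideal_pow[OF P(1) e] x(2) by blast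
    then show False using P sub unfolding basic_open_def multiring_spec_def by blast
  qed
  then have "d [^] (1::nat) \<in> principal_ideal A x" using d by simp
  then show "x \<in> S_of A d" unfolding S_of_def using x(1) by blast
qed

section \<open>Partitions of unity subordinate to a cover\<close>

text \<open>The usual passage from a family to disjoint pieces, where \<open>g\<close> is the part of \<open>\<one>\<close> not yet
  covered: a further element \<open>f\<close> with support \<open>h\<close> splits \<open>g\<close> into \<open>g h\<close>, which becomes a new piece
  inside \<open>f\<close>, and \<open>g h'\<close>, the new remainder.\<close>

lemma disjointification:
  assumes "finite F" "F \<subseteq> carrier A"
  shows "\<exists>g ds. partition_of_unity A (g # ds) \<and> (\<forall>f \<in> F. g \<otimes> f = \<zero>) \<and>
    (\<forall>d \<in> set ds. \<exists>f \<in> F. \<exists>w \<in> carrier A. d = f \<otimes> w)"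
  using assms
proof (induction F)
  case empty
  show ?case by (rule exI[of _ \<one>], rule exI[of _ "[]"]) (simp add: partition_of_unity_iff)
next
  case (insert f F)
  then obtain g ds where part: "partition_of_unity A (g # ds)" and g0: "\<forall>f \<in> F. g \<otimes> f = \<zero>"
    and ds: "\<forall>d \<in> set ds. \<exists>f \<in> F. \<exists>w \<in> carrier A. d = f \<otimes> w" by auto
  have f: "f \<in> carrier A" and F: "F \<subseteq> carrier A" using insert.prems by auto
  have g: "g \<in> carrier A" "g \<otimes> g = g" and dsc: "set ds \<subseteq> carrier A"
    and orth: "\<forall>d \<in> set ds. g \<otimes> d = \<zero>" "sorted_wrt (\<lambda>x y. x \<otimes> y = \<zero>) ds"
    and idem: "\<forall>d \<in> set ds. d \<otimes> d = d"
    using part by (auto simp: partition_of_unity_iff)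
  obtain x where x: "x \<in> hsum A ds" "\<one> \<in> g \<boxplus> x"
    using part by (auto simp: partition_of_unity_iff)
  obtain h k where h: "h \<in> carrier A" "h \<otimes> h = h" and k: "k \<in> carrier A" "f \<otimes> k = h" and fh: "f \<otimes> h = f"
    using support_idempotent[OF f] by metis
  obtain h' where h': "h' \<in> carrier A" "h' \<otimes> h' = h'" "h \<otimes> h' = \<zero>" "\<one> \<in> h' \<boxplus> h"
    using complement_idempotent[OF h] by metis
  have xc: "x \<in> carrier A" using hsum_closed[OF x(1) dsc] .
  have "g \<in> (g \<otimes> h') \<boxplus> (g \<otimes> h)"
    using weak_distrib_left[OF _ h'(1) h(1) g(1) h'(4)] g(1) by simp
  then obtain y where "y \<in> (g \<otimes> h) \<boxplus> x" "\<one> \<in> (g \<otimes> h') \<boxplus> y"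
    using add_assoc[of "g \<otimes> h'" "g \<otimes> h" x g \<one>] g(1) h(1) h'(1) xc x(2) by blast
  then have 1: "\<one> \<in> hsum A ((g \<otimes> h') # (g \<otimes> h) # ds)" using x(1) by auto
  have "(g \<otimes> h') \<otimes> (g \<otimes> h) = (g \<otimes> g) \<otimes> (h \<otimes> h')"
    using g(1) h(1) h'(1) by (simp add: m_ac)
  then have o1: "(g \<otimes> h') \<otimes> (g \<otimes> h) = \<zero>" using h'(3) g by simp
  have o2: "(g \<otimes> z) \<otimes> d = \<zero>" if "d \<in> set ds" "z \<in> carrier A" for d z
  proof -
    have "(g \<otimes> z) \<otimes> d = z \<otimes> (g \<otimes> d)" using that g(1) dsc by (simp add: m_ac subset_iff)
    then show ?thesis using that orth by simp
  qed
  have i: "(g \<otimes> z) \<otimes> (g \<otimes> z) = g \<otimes> z" if "z \<in> carrier A" "z \<otimes> z = z" for z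
  proof -
    have "(g \<otimes> z) \<otimes> (g \<otimes> z) = (g \<otimes> g) \<otimes> (z \<otimes> z)" using that(1) g(1) by (simp add: m_ac)
    then show ?thesis using that(2) g(2) by simp
  qed
  have "partition_of_unity A ((g \<otimes> h') # (g \<otimes> h) # ds)"
    unfolding partition_of_unity_iff
    using 1 o1 o2 i h h' g(1) dsc idem orth(2) by simp
  moreover have "(g \<otimes> h') \<otimes> f' = \<zero>" if "f' \<in> insert f F" for f'
  proof (cases "f' = f")
    case True
    have "(g \<otimes> h') \<otimes> f = (g \<otimes> h') \<otimes> (f \<otimes> h)" using fh by simp
    also have "\<dots> = (g \<otimes> f) \<otimes> (h \<otimes> h')" using g(1) h(1) h'(1) f by (simp add: m_ac)
    finally show ?thesis using True h'(3) g(1) f by simp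
  next
    case False
    then have "f' \<in> F" "f' \<in> carrier A" using that F by auto
    moreover have "(g \<otimes> h') \<otimes> f' = h' \<otimes> (g \<otimes> f')"
      using g(1) h'(1) \<open>f' \<in> carrier A\<close> by (simp add: m_ac)
    ultimately show ?thesis using g0 h'(1) by simp
  qed
  moreover have "\<exists>f \<in> insert f F. \<exists>w \<in> carrier A. d = f \<otimes> w" if "d \<in> set ((g \<otimes> h) # ds)" for d
  proof (cases "d \<in> set ds")
    case True
    then show ?thesis using ds by blast
  next
    case False
    then have "d = f \<otimes> (k \<otimes> g)" using that k(2)[symmetric] g(1) k(1) f by (simp add: m_ac)
    then show ?thesis using k(1) g(1) by blast
  qed
  ultimately show ?case by blast
qed

lemma subordinate_partition_of_unity:
  assumes F: "finite_cover A \<one> F"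
  shows "\<exists>ds. partition_of_unity A ds \<and> (\<forall>d \<in> set ds. \<exists>f \<in> F. \<exists>w \<in> carrier A. d = f \<otimes> w)"
proof -
  obtain g ds where part: "partition_of_unity A (g # ds)" and g0: "\<forall>f \<in> F. g \<otimes> f = \<zero>"
    and ds: "\<forall>d \<in> set ds. \<exists>f \<in> F. \<exists>w \<in> carrier A. d = f \<otimes> w"
    using disjointification[of F] F unfolding finite_cover_def by blast
  have "g \<in> carrier A" using part by (simp add: partition_of_unity_iff)
  then have "g = \<zero>" using finite_coverD[OF F, of g] g0 by simp
  moreover have "set ds \<subseteq> carrier A" using part by (simp add: partition_of_unity_iff)
  ultimately have "hsum A (g # ds) \<subseteq> hsum A ds"
    using hsum_closed by auto
  then have "partition_of_unity A ds" using part unfolding partition_of_unity_iff by auto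
  then show ?thesis using ds by blast
qed

lemma finite_cover_one_in_ideal:
  assumes "finite_cover A \<one> F" "multiring_ideal A I" "F \<subseteq> I"
  shows "\<one> \<in> I"
proof -
  obtain ds where part: "partition_of_unity A ds"
    and ds: "\<forall>d \<in> set ds. \<exists>f \<in> F. \<exists>w \<in> carrier A. d = f \<otimes> w"
    using subordinate_partition_of_unity[OF assms(1)] by blast
  have "d \<in> I" if d: "d \<in> set ds" for d
  proof -
    obtain f w where "f \<in> F" "w \<in> carrier A" "d = f \<otimes> w"
      using ds d by blast
    then show ?thesis using ideal_mult_right[OF assms(2)] assms(3) by blast
  qed
  then have "hsum A ds \<subseteq> I" by (intro hsum_subset_ideal[OF assms(2)] subsetI)
  then show ?thesis using part unfolding partition_of_unity_iff by blast
qed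

text \<open>The elements of \<open>S_u A\<close> are those that are locally equal to \<open>\<one>\<close>. They need not equal \<open>\<one>\<close>, since an
  element of a hyperring is in general not determined by its restrictions to a partition of unity.\<close>

lemma mem_S_u_iff:
  "s \<in> S_u A \<longleftrightarrow> s \<in> carrier A \<and> (\<exists>F. finite_cover A \<one> F \<and> (\<forall>f \<in> F. s \<otimes> f = f))"
proof
  assume "s \<in> S_u A"
  then obtain es where es: "partition_of_unity A es" "s \<in> hsum A es" unfolding S_u_def by blast
  then have c: "set es \<subseteq> carrier A" by (simp add: partition_of_unity_iff)
  have "finite_cover A \<one> (set es)"
    unfolding finite_cover_def using es(1) c mult_hsum_eq_zero[OF _ c]
    by (auto simp: partition_of_unity_iff simp del: r_one)
  moreover have "\<forall>e \<in> set es. s \<otimes> e = e"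
    using hsum_orthogonal[OF c _ _ es(2)] es(1) unfolding partition_of_unity_iff by blast
  ultimately show "s \<in> carrier A \<and> (\<exists>F. finite_cover A \<one> F \<and> (\<forall>f \<in> F. s \<otimes> f = f))"
    using hsum_closed[OF es(2) c] by blast
next
  assume "s \<in> carrier A \<and> (\<exists>F. finite_cover A \<one> F \<and> (\<forall>f \<in> F. s \<otimes> f = f))"
  then obtain F where s: "s \<in> carrier A" and F: "finite_cover A \<one> F" "\<And>f. f \<in> F \<Longrightarrow> s \<otimes> f = f" by blast
  obtain ds where ds: "partition_of_unity A ds" "\<forall>d \<in> set ds. \<exists>f \<in> F. \<exists>w \<in> carrier A. d = f \<otimes> w"
    using subordinate_partition_of_unity[OF F(1)] by blast
  have "s \<otimes> d = d" if d: "d \<in> set ds" for d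
  proof -
    obtain f w where "f \<in> F" "w \<in> carrier A" "d = f \<otimes> w"
      using ds(2) d by blast
    then show ?thesis
      using F(2)[of f] finite_cover_carrier[OF F(1), of f] s m_assoc[of s f w] by simp
  qed
  then have "map (\<lambda>d. s \<otimes> d) ds = ds" by (simp add: map_idI)
  then have "s \<in> hsum A ds"
    using hsum_mult[OF s, of ds \<one>] ds(1) s by (simp add: partition_of_unity_iff)
  then show "s \<in> S_u A" unfolding S_u_def using ds(1) by blast
qed

lemma S_u_multiplicative: "multiplicative A (S_u A)"
  unfolding multiplicative_def
proof (intro conjI ballI)
  show "S_u A \<subseteq> carrier A" using mem_S_u_iff by blast
  show "\<one> \<in> S_u A" unfolding mem_S_u_iff using finite_cover_self[of \<one>] by auto
next
  fix s t assume "s \<in> S_u A" "t \<in> S_u A"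
  then obtain F G where s: "s \<in> carrier A" "finite_cover A \<one> F" "\<And>f. f \<in> F \<Longrightarrow> s \<otimes> f = f"
    and t: "t \<in> carrier A" "finite_cover A \<one> G" "\<And>g. g \<in> G \<Longrightarrow> t \<otimes> g = g"
    unfolding mem_S_u_iff by blast
  have "(s \<otimes> t) \<otimes> (f \<otimes> g) = f \<otimes> g" if fg: "f \<in> F" "g \<in> G" for f g
  proof -
    have c: "f \<in> carrier A" "g \<in> carrier A"
      using fg s(2) t(2) finite_cover_carrier by blast+
    have "(s \<otimes> t) \<otimes> (f \<otimes> g) = (s \<otimes> f) \<otimes> (t \<otimes> g)" using s(1) t(1) c by (simp add: m_ac)
    then show ?thesis using s(3) t(3) fg by simp
  qed
  then show "s \<otimes> t \<in> S_u A"
    unfolding mem_S_u_iff using s(1) t(1) finite_cover_mult[OF s(2) t(2)]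
    by (intro conjI exI[of _ "(\<lambda>(f, g). f \<otimes> g) ` (F \<times> G)"]) auto
qed

text \<open>The key fact: the sums created by inverting \<open>S_u A\<close> are exactly the relations
  \<open>a \<in> b \<boxplus> c\<close> that hold locally. From left to right, multiply by a common refinement of the covers on
  which \<open>s\<close>, \<open>t\<close>, \<open>u\<close> equal \<open>\<one>\<close>. From right to left, add the relations \<open>a d \<in> b d \<boxplus> c d\<close> along a
  subordinate partition of unity and take \<open>b\<close> and \<open>c\<close> out of the resulting sums.\<close>

lemma S_u_sum_iff:
  assumes abc: "a \<in> carrier A" "b \<in> carrier A" "c \<in> carrier A"
  shows "(\<exists>s \<in> S_u A. \<exists>t \<in> S_u A. \<exists>u \<in> S_u A. a \<otimes> s \<in> (b \<otimes> t) \<boxplus> (c \<otimes> u)) \<longleftrightarrow>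
    (\<exists>F. finite_cover A \<one> F \<and> (\<forall>f \<in> F. a \<otimes> f \<in> (b \<otimes> f) \<boxplus> (c \<otimes> f)))"
proof
  assume "\<exists>s \<in> S_u A. \<exists>t \<in> S_u A. \<exists>u \<in> S_u A. a \<otimes> s \<in> (b \<otimes> t) \<boxplus> (c \<otimes> u)"
  then obtain s t u where stu: "s \<in> S_u A" "t \<in> S_u A" "u \<in> S_u A"
    and sum: "a \<otimes> s \<in> (b \<otimes> t) \<boxplus> (c \<otimes> u)" by blast
  obtain F where s: "s \<in> carrier A" "finite_cover A \<one> F" "\<And>f. f \<in> F \<Longrightarrow> s \<otimes> f = f"
    using stu(1) unfolding mem_S_u_iff by blast
  obtain G where t: "t \<in> carrier A" "finite_cover A \<one> G" "\<And>f. f \<in> G \<Longrightarrow> t \<otimes> f = f"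
    using stu(2) unfolding mem_S_u_iff by blast
  obtain H where u: "u \<in> carrier A" "finite_cover A \<one> H" "\<And>f. f \<in> H \<Longrightarrow> u \<otimes> f = f"
    using stu(3) unfolding mem_S_u_iff by blast
  let ?F = "(\<lambda>(f, g). f \<otimes> g) ` (F \<times> (\<lambda>(f, g). f \<otimes> g) ` (G \<times> H))"
  have "a \<otimes> (f \<otimes> (g \<otimes> h)) \<in> (b \<otimes> (f \<otimes> (g \<otimes> h))) \<boxplus> (c \<otimes> (f \<otimes> (g \<otimes> h)))"
    if fgh: "f \<in> F" "g \<in> G" "h \<in> H" for f g h
  proof -
    have c: "f \<in> carrier A" "g \<in> carrier A" "h \<in> carrier A"
      using fgh s(2) t(2) u(2) finite_cover_carrier by blast+
    have "a \<otimes> s \<otimes> (f \<otimes> (g \<otimes> h)) = a \<otimes> ((s \<otimes> f) \<otimes> (g \<otimes> h))"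
      "b \<otimes> t \<otimes> (f \<otimes> (g \<otimes> h)) = b \<otimes> (f \<otimes> ((t \<otimes> g) \<otimes> h))"
      "c \<otimes> u \<otimes> (f \<otimes> (g \<otimes> h)) = c \<otimes> (f \<otimes> (g \<otimes> (u \<otimes> h)))"
      using abc s(1) t(1) u(1) c by (simp_all add: m_ac)
    then have "a \<otimes> s \<otimes> (f \<otimes> (g \<otimes> h)) = a \<otimes> (f \<otimes> (g \<otimes> h))"
      "b \<otimes> t \<otimes> (f \<otimes> (g \<otimes> h)) = b \<otimes> (f \<otimes> (g \<otimes> h))"
      "c \<otimes> u \<otimes> (f \<otimes> (g \<otimes> h)) = c \<otimes> (f \<otimes> (g \<otimes> h))"
      using s(3) t(3) u(3) fgh by simp_all
    then show ?thesis
      using weak_distrib[OF _ _ _ _ sum, of "f \<otimes> (g \<otimes> h)"] abc s(1) t(1) u(1) c by simp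
  qed
  then have "\<forall>f \<in> ?F. a \<otimes> f \<in> (b \<otimes> f) \<boxplus> (c \<otimes> f)" by auto
  moreover have "finite_cover A \<one> ?F" using finite_cover_mult s(2) t(2) u(2) by blast
  ultimately show "\<exists>F. finite_cover A \<one> F \<and> (\<forall>f \<in> F. a \<otimes> f \<in> (b \<otimes> f) \<boxplus> (c \<otimes> f))" by blast
next
  assume "\<exists>F. finite_cover A \<one> F \<and> (\<forall>f \<in> F. a \<otimes> f \<in> (b \<otimes> f) \<boxplus> (c \<otimes> f))"
  then obtain F where F: "finite_cover A \<one> F" "\<And>f. f \<in> F \<Longrightarrow> a \<otimes> f \<in> (b \<otimes> f) \<boxplus> (c \<otimes> f)" by blast
  obtain ds where ds: "partition_of_unity A ds" "\<forall>d \<in> set ds. \<exists>f \<in> F. \<exists>w \<in> carrier A. d = f \<otimes> w"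
    using subordinate_partition_of_unity[OF F(1)] by blast
  then have dsc: "set ds \<subseteq> carrier A" and 1: "\<one> \<in> hsum A ds" by (auto simp: partition_of_unity_iff)
  have loc: "a \<otimes> d \<in> (b \<otimes> d) \<boxplus> (c \<otimes> d)" if d: "d \<in> set ds" for d
  proof -
    obtain f w where fw: "f \<in> F" "w \<in> carrier A" "d = f \<otimes> w"
      using ds(2) d by blast
    then have f: "f \<in> carrier A" using finite_cover_carrier[OF F(1)] by blast
    have "a \<otimes> f \<otimes> w \<in> (b \<otimes> f \<otimes> w) \<boxplus> (c \<otimes> f \<otimes> w)"
      using weak_distrib[OF _ _ _ _ F(2)[OF fw(1)]] abc f fw(2) by simp
    then show ?thesis using fw abc f m_assoc by simp
  qed
  have "a \<in> hsum A (map (\<lambda>d. a \<otimes> d) ds)" using hsum_mult[OF abc(1) dsc 1] abc by simp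
  then obtain y z where yz: "y \<in> hsum A (map (\<lambda>d. b \<otimes> d) ds)" "z \<in> hsum A (map (\<lambda>d. c \<otimes> d) ds)"
    "a \<in> y \<boxplus> z" using hsum_add[OF abc dsc loc] by blast
  obtain t u where "t \<in> hsum A ds" "y = b \<otimes> t" "u \<in> hsum A ds" "z = c \<otimes> u"
    using hsum_mult_converse[OF abc(2) dsc yz(1)] hsum_mult_converse[OF abc(3) dsc yz(2)] by blast
  moreover have "hsum A ds \<subseteq> S_u A" unfolding S_u_def using ds(1) by blast
  ultimately show "\<exists>s \<in> S_u A. \<exists>t \<in> S_u A. \<exists>u \<in> S_u A. a \<otimes> s \<in> (b \<otimes> t) \<boxplus> (c \<otimes> u)"
    using yz(3) 1 abc(1) by (intro bexI[of _ \<one>] bexI[of _ t] bexI[of _ u]) auto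
qed

end

section \<open>Marshall quotients\<close>

locale multiring_multiplicative_set = multiring A
  for A :: "('a, 'm) multiring_scheme" (structure) and S :: "'a set" +
  assumes multiplicative: "multiplicative A S"
begin

abbreviation "cl \<equiv> marshall_proj A S"
abbreviation "Q \<equiv> marshall_quotient A S"

lemma S_carrier: "s \<in> S \<Longrightarrow> s \<in> carrier A"
  and one_S: "\<one> \<in> S"
  and mult_S: "s \<in> S \<Longrightarrow> t \<in> S \<Longrightarrow> s \<otimes> t \<in> S"
  using multiplicative unfolding multiplicative_def by blast+

lemma mem_cl: "a \<in> carrier A \<Longrightarrow> a \<in> cl a"
  unfolding marshall_proj_def using one_S by auto

lemma cl_eqI:
  assumes a: "a \<in> carrier A" and b: "b \<in> carrier A" and st: "s \<in> S" "t \<in> S" and eq: "a \<otimes> s = b \<otimes> t"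
  shows "cl a = cl b"
proof -
  have *: "cl b \<subseteq> cl a"
    if a: "a \<in> carrier A" and b: "b \<in> carrier A" and st: "s \<in> S" "t \<in> S" and eq: "a \<otimes> s = b \<otimes> t"
    for a b s t
  proof
    fix x assume "x \<in> cl b"
    then obtain s' t' where x: "x \<in> carrier A" and st': "s' \<in> S" "t' \<in> S" and eq': "b \<otimes> s' = x \<otimes> t'"
      unfolding marshall_proj_def by blast
    note c = a b x st[THEN S_carrier] st'[THEN S_carrier]
    have "a \<otimes> (s \<otimes> s') = (b \<otimes> t) \<otimes> s'" using eq c by (simp add: m_assoc[symmetric])
    also have "\<dots> = (b \<otimes> s') \<otimes> t" using c by (simp add: m_ac)
    also have "\<dots> = x \<otimes> (t' \<otimes> t)" using eq' c by (simp add: m_assoc)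
    finally show "x \<in> cl a"
      unfolding marshall_proj_def using x mult_S st st' by blast
  qed
  show ?thesis using *[OF a b st eq] *[OF b a st(2,1) eq[symmetric]] by blast
qed

lemma mem_clE:
  assumes "b \<in> cl a" "a \<in> carrier A"
  obtains s t where "b \<in> carrier A" "s \<in> S" "t \<in> S" "a \<otimes> s = b \<otimes> t"
  using assms unfolding marshall_proj_def by blast

lemma cl_eqD:
  assumes "cl a = cl b" "b \<in> carrier A"
  shows "\<exists>s \<in> S. \<exists>t \<in> S. a \<otimes> s = b \<otimes> t"
proof -
  have "b \<in> cl a" using mem_cl[OF assms(2)] assms(1) by simp
  then show ?thesis unfolding marshall_proj_def by blast
qed

lemma Q_carrier: "carrier Q = cl ` carrier A"
  and Q_one: "\<one>\<^bsub>Q\<^esub> = cl \<one>"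
  and Q_zero: "\<zero>\<^bsub>Q\<^esub> = cl \<zero>"
  by (simp_all add: marshall_quotient_def)

lemma Q_carrierE:
  assumes "X \<in> carrier Q"
  obtains a where "a \<in> carrier A" "X = cl a"
  using assms Q_carrier by auto

lemma cl_closed: "a \<in> carrier A \<Longrightarrow> cl a \<in> carrier Q"
  using Q_carrier by blast

lemma Q_mult:
  assumes a: "a \<in> carrier A" and b: "b \<in> carrier A"
  shows "cl a \<otimes>\<^bsub>Q\<^esub> cl b = cl (a \<otimes> b)"
proof -
  have "cl (a' \<otimes> b') = cl (a \<otimes> b)" if a': "a' \<in> cl a" and b': "b' \<in> cl b" for a' b'
  proof -
    obtain s t where st: "a' \<in> carrier A" "s \<in> S" "t \<in> S" "a \<otimes> s = a' \<otimes> t" using mem_clE[OF a' a] .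
    obtain u v where uv: "b' \<in> carrier A" "u \<in> S" "v \<in> S" "b \<otimes> u = b' \<otimes> v" using mem_clE[OF b' b] .
    note c = a b st(1) uv(1) st(2,3)[THEN S_carrier] uv(2,3)[THEN S_carrier]
    have "(a' \<otimes> b') \<otimes> (t \<otimes> v) = (a' \<otimes> t) \<otimes> (b' \<otimes> v)" using c by (simp add: m_ac)
    also have "\<dots> = (a \<otimes> s) \<otimes> (b \<otimes> u)" using st uv by simp
    also have "\<dots> = (a \<otimes> b) \<otimes> (s \<otimes> u)" using c by (simp add: m_ac)
    finally show ?thesis using cl_eqI[of "a' \<otimes> b'" "a \<otimes> b" "t \<otimes> v" "s \<otimes> u"] c st uv mult_S by simp
  qed
  then have "(\<Union>a' \<in> cl a. \<Union>b' \<in> cl b. cl (a' \<otimes> b')) = cl (a \<otimes> b)"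
    using mem_cl[OF a] mem_cl[OF b] by blast
  then show ?thesis by (simp add: marshall_quotient_def)
qed

lemma Q_neg:
  assumes a: "a \<in> carrier A"
  shows "\<boxminus>\<^bsub>Q\<^esub> (cl a) = cl (\<boxminus> a)"
proof -
  have "cl (\<boxminus> a') = cl (\<boxminus> a)" if a': "a' \<in> cl a" for a'
  proof -
    obtain s t where st: "a' \<in> carrier A" "s \<in> S" "t \<in> S" "a \<otimes> s = a' \<otimes> t" using mem_clE[OF a' a] .
    have "(\<boxminus> a') \<otimes> t = (\<boxminus> a) \<otimes> s" using st a S_carrier by (simp add: neg_mult)
    then show ?thesis using cl_eqI[of "\<boxminus> a'" "\<boxminus> a" t s] st a by simp
  qed
  then have "(\<Union>a' \<in> cl a. cl (\<boxminus> a')) = cl (\<boxminus> a)" using mem_cl[OF a] by blast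
  then show ?thesis by (simp add: marshall_quotient_def)
qed

text \<open>Any representatives detect a sum, since the multipliers relating different representatives
  are absorbed in \<open>s\<close>, \<open>t\<close>, \<open>u\<close>. The axioms on sums in the quotient are checked
  through this criterion.\<close>

lemma Q_add_iff:
  assumes a: "a \<in> carrier A" and b: "b \<in> carrier A" and c: "c \<in> carrier A"
  shows "cl a \<in> cl b \<boxplus>\<^bsub>Q\<^esub> cl c \<longleftrightarrow>
    (\<exists>s \<in> S. \<exists>t \<in> S. \<exists>u \<in> S. a \<otimes> s \<in> (b \<otimes> t) \<boxplus> (c \<otimes> u))"
proof
  assume "\<exists>s \<in> S. \<exists>t \<in> S. \<exists>u \<in> S. a \<otimes> s \<in> (b \<otimes> t) \<boxplus> (c \<otimes> u)"
  then have "\<exists>a' \<in> cl a. \<exists>b' \<in> cl b. \<exists>c' \<in> cl c. \<exists>s \<in> S. \<exists>t \<in> S. \<exists>u \<in> S.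
      a' \<otimes> s \<in> (b' \<otimes> t) \<boxplus> (c' \<otimes> u)"
    using mem_cl[OF a] mem_cl[OF b] mem_cl[OF c] by blast
  then show "cl a \<in> cl b \<boxplus>\<^bsub>Q\<^esub> cl c"
    using a unfolding marshall_quotient_def by simp
next
  assume "cl a \<in> cl b \<boxplus>\<^bsub>Q\<^esub> cl c"
  then obtain a' b' c' s t u where mem: "a' \<in> cl a" "b' \<in> cl b" "c' \<in> cl c"
    and stu: "s \<in> S" "t \<in> S" "u \<in> S" and sum: "a' \<otimes> s \<in> (b' \<otimes> t) \<boxplus> (c' \<otimes> u)"
    unfolding marshall_quotient_def by auto
  obtain a1 a2 where A': "a' \<in> carrier A" "a1 \<in> S" "a2 \<in> S" "a \<otimes> a1 = a' \<otimes> a2" using mem_clE[OF mem(1) a] .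
  obtain b1 b2 where B': "b' \<in> carrier A" "b1 \<in> S" "b2 \<in> S" "b \<otimes> b1 = b' \<otimes> b2" using mem_clE[OF mem(2) b] .
  obtain c1 c2 where C': "c' \<in> carrier A" "c1 \<in> S" "c2 \<in> S" "c \<otimes> c1 = c' \<otimes> c2" using mem_clE[OF mem(3) c] .
  note carr = a b c A'(1) B'(1) C'(1) A'(2,3)[THEN S_carrier] B'(2,3)[THEN S_carrier]
    C'(2,3)[THEN S_carrier] stu[THEN S_carrier]
  let ?d = "a2 \<otimes> b2 \<otimes> c2"
  have "(a' \<otimes> s) \<otimes> ?d \<in> ((b' \<otimes> t) \<otimes> ?d) \<boxplus> ((c' \<otimes> u) \<otimes> ?d)"
    by (rule weak_distrib[OF _ _ _ _ sum]) (use carr in auto)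
  moreover have "(a' \<otimes> s) \<otimes> ?d = a \<otimes> (a1 \<otimes> (s \<otimes> (b2 \<otimes> c2)))"
  proof -
    have "(a' \<otimes> s) \<otimes> ?d = (a' \<otimes> a2) \<otimes> (s \<otimes> (b2 \<otimes> c2))" using carr by (simp add: m_ac)
    then show ?thesis using A'(4)[symmetric] carr by (simp add: m_assoc)
  qed
  moreover have "(b' \<otimes> t) \<otimes> ?d = b \<otimes> (b1 \<otimes> (t \<otimes> (a2 \<otimes> c2)))"
  proof -
    have "(b' \<otimes> t) \<otimes> ?d = (b' \<otimes> b2) \<otimes> (t \<otimes> (a2 \<otimes> c2))" using carr by (simp add: m_ac)
    then show ?thesis using B'(4)[symmetric] carr by (simp add: m_assoc)
  qed
  moreover have "(c' \<otimes> u) \<otimes> ?d = c \<otimes> (c1 \<otimes> (u \<otimes> (a2 \<otimes> b2)))"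
  proof -
    have "(c' \<otimes> u) \<otimes> ?d = (c' \<otimes> c2) \<otimes> (u \<otimes> (a2 \<otimes> b2))" using carr by (simp add: m_ac)
    then show ?thesis using C'(4)[symmetric] carr by (simp add: m_assoc)
  qed
  ultimately have "a \<otimes> (a1 \<otimes> (s \<otimes> (b2 \<otimes> c2)))
      \<in> (b \<otimes> (b1 \<otimes> (t \<otimes> (a2 \<otimes> c2)))) \<boxplus> (c \<otimes> (c1 \<otimes> (u \<otimes> (a2 \<otimes> b2))))"
    by (simp only:)
  moreover have "a1 \<otimes> (s \<otimes> (b2 \<otimes> c2)) \<in> S" "b1 \<otimes> (t \<otimes> (a2 \<otimes> c2)) \<in> S" "c1 \<otimes> (u \<otimes> (a2 \<otimes> b2)) \<in> S"
    by (intro mult_S A' B' C' stu)+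
  ultimately show "\<exists>s \<in> S. \<exists>t \<in> S. \<exists>u \<in> S. a \<otimes> s \<in> (b \<otimes> t) \<boxplus> (c \<otimes> u)" by blast
qed

lemma Q_addI:
  assumes "a \<in> carrier A" "b \<in> carrier A" "c \<in> carrier A" "a \<in> b \<boxplus> c"
  shows "cl a \<in> cl b \<boxplus>\<^bsub>Q\<^esub> cl c"
  unfolding Q_add_iff[OF assms(1-3)]
  using assms one_S by (intro bexI[of _ \<one>]) auto

lemma Q_add_closed: "X \<in> Y \<boxplus>\<^bsub>Q\<^esub> Z \<Longrightarrow> X \<in> carrier Q"
  unfolding marshall_quotient_def by auto

lemma cl_mult_S:
  assumes "a \<in> carrier A" "s \<in> S"
  shows "cl (a \<otimes> s) = cl a"
  by (rule cl_eqI[of _ _ \<one> s]) (use assms S_carrier one_S in auto)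

lemma Q_add_commute_subset:
  assumes "b \<in> carrier A" "c \<in> carrier A"
  shows "cl b \<boxplus>\<^bsub>Q\<^esub> cl c \<subseteq> cl c \<boxplus>\<^bsub>Q\<^esub> cl b"
proof
  fix X assume X: "X \<in> cl b \<boxplus>\<^bsub>Q\<^esub> cl c"
  obtain a where a: "a \<in> carrier A" "X = cl a" using Q_carrierE[OF Q_add_closed[OF X]] .
  then obtain s t u where "s \<in> S" "t \<in> S" "u \<in> S" "a \<otimes> s \<in> (b \<otimes> t) \<boxplus> (c \<otimes> u)"
    using X Q_add_iff assms by blast
  then have "a \<otimes> s \<in> (c \<otimes> u) \<boxplus> (b \<otimes> t)" using add_comm assms S_carrier by simp
  then show "X \<in> cl c \<boxplus>\<^bsub>Q\<^esub> cl b"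
    using Q_add_iff[OF a(1) assms(2,1)] a \<open>s \<in> S\<close> \<open>t \<in> S\<close> \<open>u \<in> S\<close> by blast
qed

lemma comm_monoid_Q: "comm_monoid Q"
proof (rule comm_monoidI)
  fix X Y assume "X \<in> carrier Q" "Y \<in> carrier Q"
  then obtain a b where "a \<in> carrier A" "X = cl a" "b \<in> carrier A" "Y = cl b" by (auto elim!: Q_carrierE)
  then show "X \<otimes>\<^bsub>Q\<^esub> Y \<in> carrier Q" "X \<otimes>\<^bsub>Q\<^esub> Y = Y \<otimes>\<^bsub>Q\<^esub> X"
    by (simp_all add: Q_mult cl_closed m_comm)
next
  fix X Y Z assume "X \<in> carrier Q" "Y \<in> carrier Q" "Z \<in> carrier Q"
  then obtain a b c where "a \<in> carrier A" "X = cl a" "b \<in> carrier A" "Y = cl b" "c \<in> carrier A" "Z = cl c"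
    by (auto elim!: Q_carrierE)
  then show "X \<otimes>\<^bsub>Q\<^esub> Y \<otimes>\<^bsub>Q\<^esub> Z = X \<otimes>\<^bsub>Q\<^esub> (Y \<otimes>\<^bsub>Q\<^esub> Z)"
    by (simp add: Q_mult m_assoc)
next
  fix X assume "X \<in> carrier Q"
  then obtain a where "a \<in> carrier A" "X = cl a" by (auto elim!: Q_carrierE)
  then show "\<one>\<^bsub>Q\<^esub> \<otimes>\<^bsub>Q\<^esub> X = X" by (simp add: Q_mult Q_one)
qed (simp add: Q_one cl_closed)

lemma multiring_Q: "multiring Q"
proof (intro multiring.intro multiring_axioms.intro comm_monoid_Q)
  show "\<zero>\<^bsub>Q\<^esub> \<in> carrier Q" by (simp add: Q_zero cl_closed)
next
  fix X assume "X \<in> carrier Q"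
  then obtain a where "a \<in> carrier A" "X = cl a" by (rule Q_carrierE)
  then show "\<boxminus>\<^bsub>Q\<^esub> X \<in> carrier Q" "X \<otimes>\<^bsub>Q\<^esub> \<zero>\<^bsub>Q\<^esub> = \<zero>\<^bsub>Q\<^esub>"
    by (simp_all add: Q_neg Q_mult Q_zero cl_closed)
next
  fix X Y assume "X \<in> carrier Q" "Y \<in> carrier Q"
  then obtain a b where X: "a \<in> carrier A" "X = cl a" and Y: "b \<in> carrier A" "Y = cl b"
    by (auto elim!: Q_carrierE)
  show "X \<boxplus>\<^bsub>Q\<^esub> Y \<subseteq> carrier Q" using Q_add_closed by blast
  obtain c where c: "c \<in> a \<boxplus> b" using add_nonempty X Y by blast
  then have "cl c \<in> X \<boxplus>\<^bsub>Q\<^esub> Y" using Q_addI X Y add_mem_closed by simp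
  then show "X \<boxplus>\<^bsub>Q\<^esub> Y \<noteq> {}" by blast
  show "X \<boxplus>\<^bsub>Q\<^esub> Y = Y \<boxplus>\<^bsub>Q\<^esub> X"
    using Q_add_commute_subset X Y by blast
  show "X \<in> Y \<boxplus>\<^bsub>Q\<^esub> \<zero>\<^bsub>Q\<^esub> \<longleftrightarrow> X = Y"
  proof
    assume "X \<in> Y \<boxplus>\<^bsub>Q\<^esub> \<zero>\<^bsub>Q\<^esub>"
    then obtain s t u where stu: "s \<in> S" "t \<in> S" "u \<in> S" "a \<otimes> s \<in> (b \<otimes> t) \<boxplus> (\<zero> \<otimes> u)"
      using Q_add_iff[OF X(1) Y(1) zero_closed] X Y Q_zero by auto
    then have "a \<otimes> s = b \<otimes> t" using Y S_carrier by simp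
    then show "X = Y" using cl_eqI X Y stu by blast
  next
    assume "X = Y"
    moreover have "cl b \<in> cl b \<boxplus>\<^bsub>Q\<^esub> cl \<zero>" using Y by (intro Q_addI) auto
    ultimately show "X \<in> Y \<boxplus>\<^bsub>Q\<^esub> \<zero>\<^bsub>Q\<^esub>" using Y Q_zero by simp
  qed
next
  fix X Y Z assume "X \<in> carrier Q" "Y \<in> carrier Q" "Z \<in> carrier Q" and sum: "X \<in> Y \<boxplus>\<^bsub>Q\<^esub> Z"
  then obtain a b c where X: "a \<in> carrier A" "X = cl a" and Y: "b \<in> carrier A" "Y = cl b"
    and Z: "c \<in> carrier A" "Z = cl c" by (auto elim!: Q_carrierE)
  obtain s t u where stu: "s \<in> S" "t \<in> S" "u \<in> S" and *: "a \<otimes> s \<in> (b \<otimes> t) \<boxplus> (c \<otimes> u)"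
    using sum Q_add_iff[OF X(1) Y(1) Z(1)] X Y Z by auto
  have carr: "a \<otimes> s \<in> carrier A" "b \<otimes> t \<in> carrier A" "c \<otimes> u \<in> carrier A"
    using X Y Z stu S_carrier by auto
  have "c \<otimes> u \<in> (\<boxminus> b \<otimes> t) \<boxplus> (a \<otimes> s)" "b \<otimes> t \<in> (a \<otimes> s) \<boxplus> (\<boxminus> c \<otimes> u)"
    using add_reversible[OF carr *] X Y Z stu S_carrier by (simp_all add: neg_mult)
  then have "cl c \<in> cl (\<boxminus> b) \<boxplus>\<^bsub>Q\<^esub> cl a" "cl b \<in> cl a \<boxplus>\<^bsub>Q\<^esub> cl (\<boxminus> c)"
    using Q_add_iff[OF Z(1) neg_closed[OF Y(1)] X(1)] Q_add_iff[OF Y(1) X(1) neg_closed[OF Z(1)]] stu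
    by blast+
  then show "Z \<in> (\<boxminus>\<^bsub>Q\<^esub> Y) \<boxplus>\<^bsub>Q\<^esub> X \<and> Y \<in> X \<boxplus>\<^bsub>Q\<^esub> (\<boxminus>\<^bsub>Q\<^esub> Z)"
    using X Y Z by (simp add: Q_neg)
next
  fix X Y Z G W
  assume "X \<in> carrier Q" "Y \<in> carrier Q" "Z \<in> carrier Q"
    and G: "G \<in> X \<boxplus>\<^bsub>Q\<^esub> Y" and W: "W \<in> G \<boxplus>\<^bsub>Q\<^esub> Z"
  then obtain a b c where X: "a \<in> carrier A" "X = cl a" and Y: "b \<in> carrier A" "Y = cl b"
    and Z: "c \<in> carrier A" "Z = cl c" by (auto elim!: Q_carrierE)
  obtain g where g: "g \<in> carrier A" "G = cl g" using Q_carrierE[OF Q_add_closed[OF G]] .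
  obtain w where w: "w \<in> carrier A" "W = cl w" using Q_carrierE[OF Q_add_closed[OF W]] .
  obtain s t u where stu: "s \<in> S" "t \<in> S" "u \<in> S" and 1: "g \<otimes> s \<in> (a \<otimes> t) \<boxplus> (b \<otimes> u)"
    using G Q_add_iff[OF g(1) X(1) Y(1)] X Y g by auto
  obtain s' t' u' where stu': "s' \<in> S" "t' \<in> S" "u' \<in> S" and 2: "w \<otimes> s' \<in> (g \<otimes> t') \<boxplus> (c \<otimes> u')"
    using W Q_add_iff[OF w(1) g(1) Z(1)] Z g w by auto
  note carr = X(1) Y(1) Z(1) g(1) w(1) stu[THEN S_carrier] stu'[THEN S_carrier]
  have "g \<otimes> s \<otimes> t' \<in> (a \<otimes> t \<otimes> t') \<boxplus> (b \<otimes> u \<otimes> t')"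
    by (rule weak_distrib[OF _ _ _ _ 1]) (use carr in auto)
  moreover have "w \<otimes> s' \<otimes> s \<in> (g \<otimes> t' \<otimes> s) \<boxplus> (c \<otimes> u' \<otimes> s)"
    by (rule weak_distrib[OF _ _ _ _ 2]) (use carr in auto)
  moreover have "g \<otimes> t' \<otimes> s = g \<otimes> s \<otimes> t'" using carr by (simp add: m_ac)
  ultimately obtain h where h: "h \<in> (b \<otimes> u \<otimes> t') \<boxplus> (c \<otimes> u' \<otimes> s)" "w \<otimes> s' \<otimes> s \<in> (a \<otimes> t \<otimes> t') \<boxplus> h"
    using add_assoc[of "a \<otimes> t \<otimes> t'" "b \<otimes> u \<otimes> t'" "c \<otimes> u' \<otimes> s"] carr by auto
  have hc: "h \<in> carrier A" using add_mem_closed[OF h(1)] carr by simp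
  have "cl h \<in> cl (b \<otimes> u \<otimes> t') \<boxplus>\<^bsub>Q\<^esub> cl (c \<otimes> u' \<otimes> s)"
    using Q_addI h(1) hc carr by simp
  then have "cl h \<in> Y \<boxplus>\<^bsub>Q\<^esub> Z" using Y Z cl_mult_S stu stu' carr by simp
  moreover have "cl (w \<otimes> s' \<otimes> s) \<in> cl (a \<otimes> t \<otimes> t') \<boxplus>\<^bsub>Q\<^esub> cl h"
    using Q_addI h(2) hc carr by simp
  then have "W \<in> X \<boxplus>\<^bsub>Q\<^esub> cl h" using X w cl_mult_S stu stu' carr by simp
  ultimately show "\<exists>H \<in> Y \<boxplus>\<^bsub>Q\<^esub> Z. W \<in> X \<boxplus>\<^bsub>Q\<^esub> H" by blast
next
  fix X Y Z W assume "X \<in> carrier Q" "Y \<in> carrier Q" "Z \<in> carrier Q" "W \<in> carrier Q"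
    and sum: "X \<in> Y \<boxplus>\<^bsub>Q\<^esub> Z"
  then obtain a b c d where X: "a \<in> carrier A" "X = cl a" and Y: "b \<in> carrier A" "Y = cl b"
    and Z: "c \<in> carrier A" "Z = cl c" and W: "d \<in> carrier A" "W = cl d" by (auto elim!: Q_carrierE)
  obtain s t u where stu: "s \<in> S" "t \<in> S" "u \<in> S" and *: "a \<otimes> s \<in> (b \<otimes> t) \<boxplus> (c \<otimes> u)"
    using sum Q_add_iff[OF X(1) Y(1) Z(1)] X Y Z by auto
  note carr = X(1) Y(1) Z(1) W(1) stu[THEN S_carrier]
  have "a \<otimes> s \<otimes> d \<in> (b \<otimes> t \<otimes> d) \<boxplus> (c \<otimes> u \<otimes> d)"
    by (rule weak_distrib[OF _ _ _ _ *]) (use carr in auto)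
  then have "(a \<otimes> d) \<otimes> s \<in> ((b \<otimes> d) \<otimes> t) \<boxplus> ((c \<otimes> d) \<otimes> u)" using carr by (simp add: m_ac)
  then have "cl (a \<otimes> d) \<in> cl (b \<otimes> d) \<boxplus>\<^bsub>Q\<^esub> cl (c \<otimes> d)"
    using Q_add_iff[of "a \<otimes> d" "b \<otimes> d" "c \<otimes> d"] carr stu by auto
  then show "X \<otimes>\<^bsub>Q\<^esub> W \<in> (Y \<otimes>\<^bsub>Q\<^esub> W) \<boxplus>\<^bsub>Q\<^esub> (Z \<otimes>\<^bsub>Q\<^esub> W)"
    using X Y Z W by (simp add: Q_mult)
qed

lemma hyperring_Q:
  assumes "hyperring A"
  shows "hyperring Q"
proof (intro hyperring.intro hyperring_axioms.intro multiring_Q)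
  fix Y Z W X assume "Y \<in> carrier Q" "Z \<in> carrier Q" "W \<in> carrier Q"
    and sum: "X \<in> (Y \<otimes>\<^bsub>Q\<^esub> W) \<boxplus>\<^bsub>Q\<^esub> (Z \<otimes>\<^bsub>Q\<^esub> W)"
  then obtain b c d where Y: "b \<in> carrier A" "Y = cl b"
    and Z: "c \<in> carrier A" "Z = cl c" and W: "d \<in> carrier A" "W = cl d" by (auto elim!: Q_carrierE)
  obtain a where X: "a \<in> carrier A" "X = cl a" using Q_carrierE[OF Q_add_closed[OF sum]] .
  have "cl a \<in> cl (b \<otimes> d) \<boxplus>\<^bsub>Q\<^esub> cl (c \<otimes> d)" using sum X Y Z W by (simp add: Q_mult)
  then obtain s t u where stu: "s \<in> S" "t \<in> S" "u \<in> S" and *: "a \<otimes> s \<in> (b \<otimes> d \<otimes> t) \<boxplus> (c \<otimes> d \<otimes> u)"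
    using Q_add_iff[of a "b \<otimes> d" "c \<otimes> d"] X Y Z W by auto
  note carr = X(1) Y(1) Z(1) W(1) stu[THEN S_carrier]
  have "a \<otimes> s \<in> ((b \<otimes> t) \<otimes> d) \<boxplus> ((c \<otimes> u) \<otimes> d)" using * carr by (simp add: m_ac)
  then obtain w where w: "w \<in> (b \<otimes> t) \<boxplus> (c \<otimes> u)" "a \<otimes> s = w \<otimes> d"
    using hyperring.strong_distrib[OF assms, of "b \<otimes> t" "c \<otimes> u" d "a \<otimes> s"] carr by auto
  have wc: "w \<in> carrier A" using add_mem_closed[OF w(1)] carr by simp
  have "cl w \<in> cl (b \<otimes> t) \<boxplus>\<^bsub>Q\<^esub> cl (c \<otimes> u)" using Q_addI w(1) wc carr by simp
  then have "cl w \<in> Y \<boxplus>\<^bsub>Q\<^esub> Z" using Y Z cl_mult_S stu by simp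
  moreover have "X = cl w \<otimes>\<^bsub>Q\<^esub> W"
    using X W wc Q_mult cl_mult_S[OF X(1) stu(1)] w(2) by simp
  ultimately show "\<exists>V \<in> Y \<boxplus>\<^bsub>Q\<^esub> Z. X = V \<otimes>\<^bsub>Q\<^esub> W" by blast
qed

lemma von_neumann_hyperring_Q:
  assumes "von_neumann_hyperring A"
  shows "von_neumann_hyperring Q"
proof (intro von_neumann_hyperring.intro von_neumann_hyperring_axioms.intro hyperring_Q)
  show "hyperring A" using assms by (rule von_neumann_hyperring.axioms)
next
  fix X assume "X \<in> carrier Q"
  then obtain a where a: "a \<in> carrier A" "X = cl a" by (rule Q_carrierE)
  obtain b where "b \<in> carrier A" "a = (a \<otimes> a) \<otimes> b"
    using von_neumann_hyperring.von_neumann_regular[OF assms a(1)] by blast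
  then have "X = (X \<otimes>\<^bsub>Q\<^esub> X) \<otimes>\<^bsub>Q\<^esub> cl b" "cl b \<in> carrier Q"
    using a by (simp_all add: Q_mult cl_closed)
  then show "\<exists>Y \<in> carrier Q. X = (X \<otimes>\<^bsub>Q\<^esub> X) \<otimes>\<^bsub>Q\<^esub> Y" by blast
qed

end

section \<open>Local von Neumann hyperrings are geometric\<close>

text \<open>The sheaf condition reduces to this one: a relation \<open>x \<in> y \<boxplus> z\<close> that holds on the members of a
  finite cover of \<open>\<one>\<close> holds globally. With \<open>z = \<zero>\<close> it says that elements are determined by
  their restrictions.\<close>

locale local_von_neumann_hyperring = von_neumann_hyperring +
  assumes local_sum:
    "\<lbrakk>finite_cover A \<one> F; x \<in> carrier A; y \<in> carrier A; z \<in> carrier A;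
      \<And>f. f \<in> F \<Longrightarrow> x \<otimes> f \<in> (y \<otimes> f) \<boxplus> (z \<otimes> f)\<rbrakk> \<Longrightarrow> x \<in> y \<boxplus> z"
begin

text \<open>Adding the complement \<open>g\<close> of \<open>e\<close> to \<open>F\<close> gives a cover of \<open>\<one>\<close>, and the relation multiplied by
  \<open>e\<close> is trivial on \<open>g\<close>.\<close>

lemma local_sum_on:
  assumes e: "e \<in> carrier A" and F: "finite_cover A e F"
    and c: "x \<in> carrier A" "y \<in> carrier A" "z \<in> carrier A"
    and loc: "\<And>f. f \<in> F \<Longrightarrow> x \<otimes> f \<in> (y \<otimes> f) \<boxplus> (z \<otimes> f)"
  shows "x \<otimes> e \<in> (y \<otimes> e) \<boxplus> (z \<otimes> e)"
proof -
  obtain h k where k: "k \<in> carrier A" and h: "h \<in> carrier A" "h \<otimes> h = h" "e \<otimes> k = h" "e \<otimes> h = e"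
    using support_idempotent[OF e] .
  obtain g where g: "g \<in> carrier A" "g \<otimes> g = g" "h \<otimes> g = \<zero>" "\<one> \<in> g \<boxplus> h"
    using complement_idempotent[OF h(1,2)] .
  have "e \<otimes> g = e \<otimes> h \<otimes> g" using h by simp
  then have eg: "e \<otimes> g = \<zero>" using m_assoc[OF e h(1) g(1)] g(3) e by simp
  have "finite_cover A \<one> (insert g F)"
    unfolding finite_cover_def
  proof (intro conjI ballI impI)
    fix w assume w: "w \<in> carrier A" and 0: "\<forall>f \<in> insert g F. w \<otimes> f = \<zero>"
    have "w \<otimes> e = \<zero>" using finite_coverD[OF F w] 0 by blast
    then have "w \<otimes> h = \<zero>" using m_assoc[OF w e k] h(3) k by simp
    then show "w \<otimes> \<one> = \<zero>"
      using weak_distrib_left[OF one_closed g(1) h(1) w g(4)] 0 by simp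
  qed (use F g in \<open>auto simp: finite_cover_def\<close>)
  moreover have "(x \<otimes> e) \<otimes> f \<in> (y \<otimes> e \<otimes> f) \<boxplus> (z \<otimes> e \<otimes> f)" if f: "f \<in> insert g F" for f
  proof (cases "f = g")
    case True
    then show ?thesis using c e g(1) eg by (simp add: m_assoc)
  next
    case False
    then have f: "f \<in> F" using f by blast
    then have fc: "f \<in> carrier A" using finite_cover_carrier[OF F] by blast
    have "x \<otimes> f \<otimes> e \<in> (y \<otimes> f \<otimes> e) \<boxplus> (z \<otimes> f \<otimes> e)"
      by (rule weak_distrib[OF _ _ _ _ loc[OF f]]) (use c fc e in auto)
    then show ?thesis using c fc e by (simp add: m_ac)
  qed
  ultimately show ?thesis
    using local_sum[of "insert g F" "x \<otimes> e" "y \<otimes> e" "z \<otimes> e"] c e by blast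
qed

lemma local_eq_on:
  assumes "e \<in> carrier A" "finite_cover A e F" "x \<in> carrier A" "y \<in> carrier A"
    and "\<And>f. f \<in> F \<Longrightarrow> x \<otimes> f = y \<otimes> f"
  shows "x \<otimes> e = y \<otimes> e"
proof -
  have "x \<otimes> e \<in> (y \<otimes> e) \<boxplus> (\<zero> \<otimes> e)"
    by (rule local_sum_on[OF assms(1-4)]) (use assms(5) finite_cover_carrier[OF assms(2)] assms(4) in auto)
  then show ?thesis using assms by simp
qed

lemma basic_cover_restr:
  assumes cov: "basic_cover A e E" and d: "d \<in> E"
  shows "S_of A e \<subseteq> S_of A d"
  using S_of_antimono[of d e] cov d unfolding basic_cover_def by blast

text \<open>After clearing denominators, a relation in \<open>S\<^sub>d\<^sup>-\<^sup>1A\<close> becomes a relation multiplied by \<open>d\<close>. By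
  compactness finitely many such \<open>d\<close> cover \<open>e\<close>, so the relation holds multiplied by \<open>e\<close>, which is a
  relation in \<open>A\<^sub>e\<close>.\<close>

lemma monopresheaf: "monopresheaf A"
  unfolding monopresheaf_def
proof (intro allI impI ballI)
  fix e E \<alpha> \<beta> \<gamma>
  assume cov: "basic_cover A e E" and carr: "\<alpha> \<in> carrier (localize_at A e)"
    "\<beta> \<in> carrier (localize_at A e)" "\<gamma> \<in> carrier (localize_at A e)"
    and loc: "\<forall>d \<in> E. presheaf_restr A e d (localize_at_to_presheaf A e \<alpha>)
      \<in> presheaf_restr A e d (localize_at_to_presheaf A e \<beta>)
        \<boxplus>\<^bsub>presheaf A d\<^esub> presheaf_restr A e d (localize_at_to_presheaf A e \<gamma>)"
  have e: "e \<in> carrier A" and E: "E \<subseteq> carrier A" using cov unfolding basic_cover_def by auto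
  let ?P = "powers A e"
  note P = powers_multiplicative[OF e]
  have Pc: "?P \<subseteq> carrier A" using P unfolding multiplicative_def by blast
  obtain a s where a: "a \<in> carrier A" "s \<in> ?P" "\<alpha> = frac A ?P a s"
    using localization_cases carr(1) unfolding localize_at_def by metis
  obtain b t where b: "b \<in> carrier A" "t \<in> ?P" "\<beta> = frac A ?P b t"
    using localization_cases carr(2) unfolding localize_at_def by metis
  obtain c u where c: "c \<in> carrier A" "u \<in> ?P" "\<gamma> = frac A ?P c u"
    using localization_cases carr(3) unfolding localize_at_def by metis
  have stu: "s \<in> carrier A" "t \<in> carrier A" "u \<in> carrier A" using a b c Pc by auto
  have restr: "presheaf_restr A e d (localize_at_to_presheaf A e (frac A ?P x r)) = frac A (S_of A d) x r"
    if d: "d \<in> E" and x: "x \<in> carrier A" "r \<in> ?P" for d x r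
  proof -
    have dc: "d \<in> carrier A" using d E by blast
    have r: "r \<in> S_of A e" using powers_subset_S_of[OF e] x(2) by blast
    show ?thesis
      unfolding presheaf_restr_def localize_at_to_presheaf_def
      using localization_map_frac[OF P S_of_multiplicative[OF e] powers_subset_S_of[OF e] x]
        localization_map_frac[OF S_of_multiplicative[OF e] S_of_multiplicative[OF dc]
          basic_cover_restr[OF cov d] x(1) r] by simp
  qed
  have "(a \<otimes> t \<otimes> u) \<otimes> d \<in> ((b \<otimes> s \<otimes> u) \<otimes> d) \<boxplus> ((c \<otimes> s \<otimes> t) \<otimes> d)" if d: "d \<in> E" for d
  proof -
    have dc: "d \<in> carrier A" using d E by blast
    have sub: "?P \<subseteq> S_of A d"
      using powers_subset_S_of[OF e] basic_cover_restr[OF cov d] by blast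
    have "frac A (S_of A d) a s \<in> frac A (S_of A d) b t \<boxplus>\<^bsub>localization A (S_of A d)\<^esub> frac A (S_of A d) c u"
      using bspec[OF loc d] restr[OF d] a b c by (simp add: presheaf_def)
    then obtain v where v: "v \<in> S_of A d"
      "a \<otimes> t \<otimes> u \<otimes> v \<in> (b \<otimes> s \<otimes> u \<otimes> v) \<boxplus> (c \<otimes> s \<otimes> t \<otimes> v)"
      using localization_addD[OF S_of_multiplicative[OF dc], of a b c s t u] a b c sub by blast
    have vc: "v \<in> carrier A" using v(1) unfolding S_of_def by blast
    obtain w where w: "w \<in> carrier A" "d = v \<otimes> w" using S_of_factor[OF dc v(1)] by blast
    have "a \<otimes> t \<otimes> u \<otimes> v \<otimes> w \<in> (b \<otimes> s \<otimes> u \<otimes> v \<otimes> w) \<boxplus> (c \<otimes> s \<otimes> t \<otimes> v \<otimes> w)"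
      by (rule weak_distrib[OF _ _ _ _ v(2)]) (use a b c stu vc w in auto)
    then show ?thesis using a b c stu vc w by (simp add: m_assoc)
  qed
  moreover obtain F where F: "F \<subseteq> E" "finite_cover A e F"
    using basic_open_compact[OF e E] cov unfolding basic_cover_def by blast
  ultimately have "(a \<otimes> t \<otimes> u) \<otimes> e \<in> ((b \<otimes> s \<otimes> u) \<otimes> e) \<boxplus> ((c \<otimes> s \<otimes> t) \<otimes> e)"
    using a b c stu by (intro local_sum_on[OF e F(2)]) auto
  then show "\<alpha> \<in> \<beta> \<boxplus>\<^bsub>localize_at A e\<^esub> \<gamma>"
    unfolding localize_at_def a(3) b(3) c(3)
    by (intro localization_addI[OF P a(1) b(1) c(1) a(2) b(2) c(2) self_mem_powers[OF e]])
qed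

text \<open>One section is added at a time: \<open>z \<in> y g \<boxplus> c\<^sub>d h\<close> agrees with \<open>y\<close> off \<open>D(d)\<close> and with \<open>c\<^sub>d\<close> on it,
  where \<open>h\<close> is the support of \<open>d\<close> and \<open>g\<close> its complement. Such a \<open>z\<close> exists in every von Neumann
  hyperring; that it still restricts to \<open>c\<^sub>f\<close> on the earlier \<open>f\<close>, which may overlap both parts, is
  where locality enters.\<close>

lemma finite_gluing:
  assumes "finite F" "F \<subseteq> carrier A" "\<And>f. f \<in> F \<Longrightarrow> c f \<in> carrier A"
    and "\<And>f f'. \<lbrakk>f \<in> F; f' \<in> F\<rbrakk> \<Longrightarrow> c f \<otimes> (f \<otimes> f') = c f' \<otimes> (f \<otimes> f')"
  shows "\<exists>y \<in> carrier A. \<forall>f \<in> F. y \<otimes> f = c f \<otimes> f"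
  using assms
proof (induction F)
  case empty
  show ?case by auto
next
  case (insert d F)
  have "\<exists>y \<in> carrier A. \<forall>f \<in> F. y \<otimes> f = c f \<otimes> f"
    by (rule insert.IH) (use insert.prems in blast)+
  then obtain y where y: "y \<in> carrier A" "\<And>f. f \<in> F \<Longrightarrow> y \<otimes> f = c f \<otimes> f" by blast
  have d: "d \<in> carrier A" and cd: "c d \<in> carrier A" using insert.prems by auto
  obtain h k where k: "k \<in> carrier A" and h: "h \<in> carrier A" "h \<otimes> h = h" "d \<otimes> k = h" "d \<otimes> h = d"
    using support_idempotent[OF d] .
  obtain g where g: "g \<in> carrier A" "g \<otimes> g = g" "h \<otimes> g = \<zero>" "\<one> \<in> g \<boxplus> h"
    using complement_idempotent[OF h(1,2)] .
  have cov: "finite_cover A \<one> {g, h}"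
    unfolding finite_cover_def
  proof (intro conjI ballI impI)
    fix w assume w: "w \<in> carrier A" and 0: "\<forall>f \<in> {g, h}. w \<otimes> f = \<zero>"
    then show "w \<otimes> \<one> = \<zero>"
      using weak_distrib_left[OF one_closed g(1) h(1) w g(4)] by simp
  qed (use g h in auto)
  obtain z where z: "z \<in> (y \<otimes> g) \<boxplus> (c d \<otimes> h)"
    using add_nonempty[of "y \<otimes> g" "c d \<otimes> h"] y(1) g(1) cd h(1) by auto
  have zc: "z \<in> carrier A" using add_mem_closed[OF z] y(1) g(1) cd h(1) by simp
  have "z \<otimes> g \<in> ((y \<otimes> g) \<otimes> g) \<boxplus> ((c d \<otimes> h) \<otimes> g)"
    by (rule weak_distrib[OF _ _ _ _ z]) (use zc y(1) g(1) cd h(1) in auto)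
  then have zg: "z \<otimes> g = y \<otimes> g" using y(1) g cd h(1) by (simp add: m_assoc)
  have "g \<otimes> h = \<zero>" using g(3) m_comm[OF g(1) h(1)] by simp
  moreover have "z \<otimes> h \<in> ((y \<otimes> g) \<otimes> h) \<boxplus> ((c d \<otimes> h) \<otimes> h)"
    by (rule weak_distrib[OF _ _ _ _ z]) (use zc y(1) g(1) cd h(1) in auto)
  ultimately have zh: "z \<otimes> h = c d \<otimes> h" using y(1) g(1) cd h by (simp add: m_assoc)
  have "z \<otimes> d = (z \<otimes> h) \<otimes> d" using h(4) m_assoc[OF zc h(1) d] m_comm[OF h(1) d] by simp
  also have "\<dots> = c d \<otimes> d" using zh h(4) m_assoc[OF cd h(1) d] m_comm[OF h(1) d] by simp
  finally have zd: "z \<otimes> d = c d \<otimes> d" .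
  have "z \<otimes> f = c f \<otimes> f" if f: "f \<in> F" for f
  proof -
    have fc: "f \<in> carrier A" and cf: "c f \<in> carrier A" using f insert.prems by auto
    have "(z \<otimes> f) \<otimes> g = (z \<otimes> g) \<otimes> f" using zc fc g(1) by (simp add: m_ac)
    also have "\<dots> = (y \<otimes> f) \<otimes> g" using zg y(1) fc g(1) by (simp add: m_ac)
    finally have onG: "(z \<otimes> f) \<otimes> g = (y \<otimes> f) \<otimes> g" .
    have "(z \<otimes> f) \<otimes> h = (z \<otimes> h) \<otimes> f" using zc fc h(1) by (simp add: m_ac)
    also have "\<dots> = (c d \<otimes> (d \<otimes> f)) \<otimes> k"
      using zh h(3)[symmetric] cd d k fc by (simp add: m_ac)
    also have "\<dots> = (c f \<otimes> (d \<otimes> f)) \<otimes> k" using insert.prems(3)[of d f] f by simp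
    also have "\<dots> = (c f \<otimes> f) \<otimes> h" using h(3)[symmetric] cf d k fc by (simp add: m_ac)
    also have "\<dots> = (y \<otimes> f) \<otimes> h" using y(2)[OF f] by simp
    finally have "(z \<otimes> f) \<otimes> h = (y \<otimes> f) \<otimes> h" .
    then have "(z \<otimes> f) \<otimes> \<one> = (y \<otimes> f) \<otimes> \<one>"
      using onG zc y(1) fc by (intro local_eq_on[OF one_closed cov]) auto
    then show ?thesis using zc y fc cf f by simp
  qed
  then show ?case using zc zd by blast
qed

text \<open>On \<open>D(d)\<close> a denominator \<open>s\<close> divides \<open>d\<close>, and \<open>d\<close> has the inverse \<open>k\<close> there; so
  \<open>s\<close> is inverted by an element of \<open>A\<close>.\<close>

lemma presheaf_integral_representative:
  assumes d: "d \<in> carrier A" and X: "X \<in> carrier (presheaf A d)"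
  shows "\<exists>c \<in> carrier A. X = frac A (S_of A d) c \<one>"
proof -
  note S = S_of_multiplicative[OF d]
  obtain a s where a: "a \<in> carrier A" "s \<in> S_of A d" "X = frac A (S_of A d) a s"
    using localization_cases X unfolding presheaf_def by metis
  have s: "s \<in> carrier A" using a(2) unfolding S_of_def by blast
  have one: "\<one> \<in> S_of A d" using S unfolding multiplicative_def by blast
  have dS: "d \<in> S_of A d" using powers_subset_S_of[OF d] self_mem_powers[OF d] by blast
  obtain w where w: "w \<in> carrier A" "d = s \<otimes> w" using S_of_factor[OF d a(2)] by blast
  obtain k where k: "k \<in> carrier A" "d \<otimes> d \<otimes> k = d" using quasi_inverse[OF d] .
  have "a \<otimes> (w \<otimes> k) \<otimes> s \<otimes> d = a \<otimes> ((s \<otimes> w) \<otimes> d \<otimes> k)" using a(1) s w(1) k(1) d by (simp add: m_ac)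
  also have "\<dots> = a \<otimes> d" using w(2) k(2) by simp
  finally have "a \<otimes> \<one> \<otimes> d = a \<otimes> (w \<otimes> k) \<otimes> s \<otimes> d" using a(1) by simp
  then have "X = frac A (S_of A d) (a \<otimes> (w \<otimes> k)) \<one>"
    unfolding a(3) using frac_eqI[OF S a(1,2) _ one dS] a(1) w(1) k(1) by simp
  then show ?thesis using a(1) w(1) k(1) by blast
qed

text \<open>Sections are represented by elements \<open>c\<^sub>d\<close> of \<open>A\<close> that agree after multiplication by
  \<open>d d'\<close>. A finite subcover suffices to construct \<open>y\<close>, and \<open>y\<close> agrees with \<open>c\<^sub>d\<close> on every other \<open>d\<close>
  too, because the subcover also covers \<open>d\<close>.\<close>

lemma gluing:
  assumes cov: "basic_cover A e E" and x: "\<And>d. d \<in> E \<Longrightarrow> x d \<in> carrier (presheaf A d)"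
    and compat: "\<And>d d'. \<lbrakk>d \<in> E; d' \<in> E\<rbrakk> \<Longrightarrow>
      presheaf_restr A d (d \<otimes> d') (x d) = presheaf_restr A d' (d \<otimes> d') (x d')"
  shows "\<exists>y \<in> carrier (presheaf A e). \<forall>d \<in> E. presheaf_restr A e d y = x d"
proof -
  have e: "e \<in> carrier A" and E: "E \<subseteq> carrier A" using cov unfolding basic_cover_def by auto
  have one: "\<one> \<in> S_of A d" if "d \<in> carrier A" for d
    using S_of_multiplicative[OF that] unfolding multiplicative_def by blast
  have restr: "presheaf_restr A b d (frac A (S_of A b) a \<one>) = frac A (S_of A d) a \<one>"
    if "b \<in> carrier A" "d \<in> carrier A" "S_of A b \<subseteq> S_of A d" "a \<in> carrier A" for a b d
    unfolding presheaf_restr_def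
    using localization_map_frac[OF S_of_multiplicative S_of_multiplicative] that one by blast
  have "\<forall>d \<in> E. \<exists>c. c \<in> carrier A \<and> x d = frac A (S_of A d) c \<one>"
    using presheaf_integral_representative x E by blast
  then obtain c where c: "\<And>d. d \<in> E \<Longrightarrow> c d \<in> carrier A"
    and xc: "\<And>d. d \<in> E \<Longrightarrow> x d = frac A (S_of A d) (c d) \<one>"
    using bchoice[of E] by metis
  have agree: "c d \<otimes> (d \<otimes> d') = c d' \<otimes> (d \<otimes> d')" if dd': "d \<in> E" "d' \<in> E" for d d'
  proof -
    have dc: "d \<in> carrier A" "d' \<in> carrier A" using dd' E by auto
    then have dd: "d \<otimes> d' \<in> carrier A" by simp
    have "basic_open A (d \<otimes> d') \<subseteq> basic_open A d \<inter> basic_open A d'"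
      unfolding basic_open_def multiring_spec_def multiring_prime_ideal_def
      using ideal_mult ideal_mult_right dc by blast
    then have sub: "S_of A d \<subseteq> S_of A (d \<otimes> d')" "S_of A d' \<subseteq> S_of A (d \<otimes> d')"
      using S_of_antimono[OF dd] dc by auto
    have "frac A (S_of A (d \<otimes> d')) (c d) \<one> = frac A (S_of A (d \<otimes> d')) (c d') \<one>"
      using compat[OF dd'] restr[OF dc(1) dd sub(1) c[OF dd'(1)]] restr[OF dc(2) dd sub(2) c[OF dd'(2)]]
        xc dd' by simp
    then obtain u where u: "u \<in> S_of A (d \<otimes> d')" "c d \<otimes> \<one> \<otimes> u = c d' \<otimes> \<one> \<otimes> u"
      using frac_eqD[OF S_of_multiplicative[OF dd] c[OF dd'(2)] one[OF dd]] by blast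
    obtain w where w: "w \<in> carrier A" "d \<otimes> d' = u \<otimes> w" using S_of_factor[OF dd u(1)] by blast
    have uc: "u \<in> carrier A" using u(1) unfolding S_of_def by blast
    have "c d \<otimes> u \<otimes> w = c d' \<otimes> u \<otimes> w" using u(2) c dd' by simp
    then show ?thesis using w uc c dd' m_assoc by simp
  qed
  obtain F where F: "F \<subseteq> E" "finite_cover A e F"
    using basic_open_compact[OF e E] cov unfolding basic_cover_def by blast
  have "finite F" "F \<subseteq> carrier A" using F(2) unfolding finite_cover_def by auto
  then have "\<exists>y \<in> carrier A. \<forall>f \<in> F. y \<otimes> f = c f \<otimes> f"
    by (rule finite_gluing) (use F(1) c agree in blast)+
  then obtain y where y: "y \<in> carrier A" "\<And>f. f \<in> F \<Longrightarrow> y \<otimes> f = c f \<otimes> f" by blast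
  have "presheaf_restr A e d (frac A (S_of A e) y \<one>) = x d" if d: "d \<in> E" for d
  proof -
    have dc: "d \<in> carrier A" using d E by blast
    have sub: "S_of A e \<subseteq> S_of A d" using basic_cover_restr[OF cov d] .
    have "basic_open A d \<subseteq> basic_open A e" using cov d unfolding basic_cover_def by blast
    then obtain G where G: "G \<subseteq> {e}" "finite_cover A d G"
      using basic_open_compact[of d "{e}"] dc e by auto
    have "finite_cover A d F"
      unfolding finite_cover_def
    proof (intro conjI ballI impI)
      fix w assume w: "w \<in> carrier A" "\<forall>f \<in> F. w \<otimes> f = \<zero>"
      then have "w \<otimes> e = \<zero>" using finite_coverD[OF F(2)] by blast
      then show "w \<otimes> d = \<zero>" using finite_coverD[OF G(2) w(1)] G(1) by blast
    qed (use F E in \<open>auto simp: finite_cover_def\<close>)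
    moreover have "(y \<otimes> d) \<otimes> f = (c d \<otimes> d) \<otimes> f" if f: "f \<in> F" for f
    proof -
      have fE: "f \<in> E" and fc: "f \<in> carrier A" using f F(1) E by auto
      have "(y \<otimes> d) \<otimes> f = (y \<otimes> f) \<otimes> d" using y(1) dc fc by (simp add: m_ac)
      also have "\<dots> = c f \<otimes> (d \<otimes> f)" using y(2)[OF f] c[OF fE] dc fc by (simp add: m_ac)
      also have "\<dots> = (c d \<otimes> d) \<otimes> f" using agree[OF d fE] c[OF d] dc fc by (simp add: m_assoc)
      finally show ?thesis .
    qed
    ultimately have "(y \<otimes> d) \<otimes> d = (c d \<otimes> d) \<otimes> d"
      using y(1) dc c[OF d] by (intro local_eq_on[OF dc]) auto
    then have "y \<otimes> \<one> \<otimes> (d \<otimes> d) = c d \<otimes> \<one> \<otimes> (d \<otimes> d)" using y(1) dc c[OF d] by (simp add: m_assoc)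
    moreover have "d \<in> S_of A d" using powers_subset_S_of[OF dc] self_mem_powers[OF dc] by blast
    then have "d \<otimes> d \<in> S_of A d" using S_of_multiplicative[OF dc] unfolding multiplicative_def by blast
    ultimately have "frac A (S_of A d) y \<one> = frac A (S_of A d) (c d) \<one>"
      using frac_eqI[OF S_of_multiplicative[OF dc] y(1) one[OF dc] c[OF d] one[OF dc]] by blast
    then show ?thesis using restr[OF e dc sub y(1)] xc[OF d] by simp
  qed
  moreover have "frac A (S_of A e) y \<one> \<in> carrier (presheaf A e)"
    unfolding presheaf_def using frac_closed[OF y(1) one[OF e]] .
  ultimately show ?thesis by blast
qed

lemma geometric: "geometric_multiring A"
proof (intro geometric_multiring.intro geometric_multiring_axioms.intro)
  show "structural_sheaf A"
    unfolding structural_sheaf_def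
    using monopresheaf gluing by blast
qed (rule multiring_axioms)

end

section \<open>Sums in mono-multirings\<close>

text \<open>The hypothesis on ideals says that no prime ideal contains \<open>E\<close>, so the \<open>D(e)\<close> cover
  \<open>D(\<one>)\<close>. As \<open>{\<one>, \<one>\<^sup>2, \<dots>} = {\<one>}\<close>, the monopresheaf property at \<open>\<one>\<close> concludes in \<open>A\<close> itself.\<close>

lemma (in mono_multiring) sum_from_cover:
  assumes a: "a \<in> carrier A" and b: "b \<in> carrier A" and c: "c \<in> carrier A" and E: "E \<subseteq> carrier A"
    and unit: "\<And>I. \<lbrakk>multiring_ideal A I; E \<subseteq> I\<rbrakk> \<Longrightarrow> \<one> \<in> I"
    and loc: "\<And>e. e \<in> E \<Longrightarrow> a \<otimes> e \<in> (b \<otimes> e) \<boxplus> (c \<otimes> e)"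
  shows "a \<in> b \<boxplus> c"
proof -
  have "\<exists>d \<in> E. P \<in> basic_open A d" if P: "P \<in> basic_open A \<one>" for P
  proof -
    have "multiring_ideal A P" "\<one> \<notin> P"
      using P unfolding basic_open_def multiring_spec_def multiring_prime_ideal_def by auto
    then have "\<not> E \<subseteq> P" using unit by blast
    then show ?thesis using P unfolding basic_open_def by blast
  qed
  moreover have "basic_open A d \<subseteq> basic_open A \<one>" for d
    unfolding basic_open_def multiring_spec_def multiring_prime_ideal_def by blast
  ultimately have cov: "basic_cover A \<one> E"
    unfolding basic_cover_def using E by blast
  note P = powers_multiplicative[OF one_closed]
  have one: "\<one> \<in> powers A \<one>" using powers_one by simp
  let ?i = "\<lambda>x. frac A (powers A \<one>) x \<one>"
  have S1: "S_of A \<one> \<subseteq> S_of A d" if "d \<in> carrier A" for d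
  proof
    fix x assume "x \<in> S_of A \<one>"
    then have "x \<in> carrier A" "d [^] (0::nat) \<in> principal_ideal A x"
      unfolding S_of_def by auto
    then show "x \<in> S_of A d" unfolding S_of_def by blast
  qed
  have restr: "presheaf_restr A \<one> d (localize_at_to_presheaf A \<one> (?i x)) = frac A (S_of A d) x \<one>"
    if d: "d \<in> carrier A" and x: "x \<in> carrier A" for d x
    unfolding presheaf_restr_def localize_at_to_presheaf_def
    using localization_map_frac[OF P S_of_multiplicative[OF one_closed] powers_subset_S_of[OF one_closed] x one]
      localization_map_frac[OF S_of_multiplicative[OF one_closed] S_of_multiplicative[OF d] S1[OF d] x]
      powers_subset_S_of[OF one_closed] one by auto
  have "presheaf_restr A \<one> d (localize_at_to_presheaf A \<one> (?i a))
      \<in> presheaf_restr A \<one> d (localize_at_to_presheaf A \<one> (?i b))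
        \<boxplus>\<^bsub>presheaf A d\<^esub> presheaf_restr A \<one> d (localize_at_to_presheaf A \<one> (?i c))"
    if d: "d \<in> E" for d
  proof -
    have dc: "d \<in> carrier A" using d E by blast
    have dS: "d \<in> S_of A d" using powers_subset_S_of[OF dc] self_mem_powers[OF dc] by blast
    have one': "\<one> \<in> S_of A d" using S_of_multiplicative[OF dc] unfolding multiplicative_def by blast
    show ?thesis
      unfolding restr[OF dc a] restr[OF dc b] restr[OF dc c] presheaf_def
      by (rule localization_addI[OF S_of_multiplicative[OF dc] a b c one' one' one' dS])
        (use loc[OF d] a b c in simp)
  qed
  then have "?i a \<in> ?i b \<boxplus>\<^bsub>localize_at A \<one>\<^esub> ?i c"
    using mono cov frac_closed[OF a one] frac_closed[OF b one] frac_closed[OF c one]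
    unfolding monopresheaf_def localize_at_def by blast
  then obtain v where "v \<in> powers A \<one>" "a \<otimes> \<one> \<otimes> \<one> \<otimes> v \<in> (b \<otimes> \<one> \<otimes> \<one> \<otimes> v) \<boxplus> (c \<otimes> \<one> \<otimes> \<one> \<otimes> v)"
    using localization_addD[OF P a b c one one one] unfolding localize_at_def by blast
  then show ?thesis using a b c powers_one by simp
qed

section \<open>The quotient by the sums of partitions of unity\<close>

context von_neumann_hyperring
begin

lemma multiring_multiplicative_set_S_u: "multiring_multiplicative_set A (S_u A)"
  by (intro multiring_multiplicative_set.intro multiring_multiplicative_set_axioms.intro
      multiring_axioms S_u_multiplicative)

interpretation U: multiring_multiplicative_set A "S_u A"
  by (rule multiring_multiplicative_set_S_u)

lemma S_u_quotient_add_iff: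
  assumes "a \<in> carrier A" "b \<in> carrier A" "c \<in> carrier A"
  shows "U.cl a \<in> U.cl b \<boxplus>\<^bsub>U.Q\<^esub> U.cl c \<longleftrightarrow>
    (\<exists>F. finite_cover A \<one> F \<and> (\<forall>f \<in> F. a \<otimes> f \<in> (b \<otimes> f) \<boxplus> (c \<otimes> f)))"
  using U.Q_add_iff[OF assms] S_u_sum_iff[OF assms] by simp

text \<open>Elements of \<open>S_u A\<close> are locally \<open>\<one>\<close>, so they annihilate nothing else than \<open>\<zero>\<close>. Hence covers of
  \<open>\<one>\<close> in the quotient lift to covers of \<open>\<one>\<close> in \<open>A\<close>.\<close>

lemma S_u_quotient_eq_zero:
  assumes a: "a \<in> carrier A" and "U.cl a = U.cl \<zero>"
  shows "a = \<zero>"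
proof -
  obtain s t where "s \<in> S_u A" "t \<in> S_u A" "a \<otimes> s = \<zero> \<otimes> t"
    using U.cl_eqD[OF assms(2)] by auto
  then have s: "s \<in> S_u A" "a \<otimes> s = \<zero>" using U.S_carrier by auto
  then obtain F where F: "finite_cover A \<one> F" "\<And>f. f \<in> F \<Longrightarrow> s \<otimes> f = f" and sc: "s \<in> carrier A"
    unfolding mem_S_u_iff by blast
  have "a \<otimes> f = \<zero>" if f: "f \<in> F" for f
  proof -
    have fc: "f \<in> carrier A" using finite_cover_carrier[OF F(1) f] .
    have "a \<otimes> f = (a \<otimes> s) \<otimes> f" using F(2)[OF f] m_assoc[OF a sc fc] by simp
    then show ?thesis using s(2) fc by simp
  qed
  then have "a \<otimes> \<one> = \<zero>" using finite_coverD[OF F(1) a] by blast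
  then show ?thesis using a by simp
qed

text \<open>Locality is transitive: a relation of the quotient that holds on a cover \<open>F\<close> holds in \<open>A\<close>, for
  each \<open>f \<in> F\<close>, on a cover \<open>G f\<close>, and the products \<open>f g\<close> cover \<open>\<one>\<close> again.\<close>

lemma S_u_quotient_local: "local_von_neumann_hyperring U.Q"
proof (intro local_von_neumann_hyperring.intro local_von_neumann_hyperring_axioms.intro)
  show "von_neumann_hyperring U.Q"
    by (rule U.von_neumann_hyperring_Q) (rule von_neumann_hyperring_axioms)
next
  fix \<F> X Y Z
  assume cov: "finite_cover U.Q \<one>\<^bsub>U.Q\<^esub> \<F>"
    and "X \<in> carrier U.Q" "Y \<in> carrier U.Q" "Z \<in> carrier U.Q"
    and loc: "\<And>\<phi>. \<phi> \<in> \<F> \<Longrightarrow> X \<otimes>\<^bsub>U.Q\<^esub> \<phi> \<in> (Y \<otimes>\<^bsub>U.Q\<^esub> \<phi>) \<boxplus>\<^bsub>U.Q\<^esub> (Z \<otimes>\<^bsub>U.Q\<^esub> \<phi>)"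
  then obtain a b c where X: "a \<in> carrier A" "X = U.cl a" and Y: "b \<in> carrier A" "Y = U.cl b"
    and Z: "c \<in> carrier A" "Z = U.cl c" by (auto elim!: U.Q_carrierE)
  have fin: "finite \<F>" and "\<F> \<subseteq> U.cl ` carrier A"
    using cov U.Q_carrier unfolding finite_cover_def by auto
  then obtain F where F: "F \<subseteq> carrier A" "finite F" "\<F> = U.cl ` F"
    using finite_subset_image by metis
  have covF: "finite_cover A \<one> F"
    unfolding finite_cover_def
  proof (intro conjI ballI impI F)
    fix y assume y: "y \<in> carrier A" and 0: "\<forall>f \<in> F. y \<otimes> f = \<zero>"
    have "U.cl y \<otimes>\<^bsub>U.Q\<^esub> \<phi> = \<zero>\<^bsub>U.Q\<^esub>" if "\<phi> \<in> \<F>" for \<phi>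
      using that F 0 y U.Q_mult[OF y] U.Q_zero by auto
    then have "U.cl y \<otimes>\<^bsub>U.Q\<^esub> \<one>\<^bsub>U.Q\<^esub> = \<zero>\<^bsub>U.Q\<^esub>"
      using multiring.finite_coverD[OF U.multiring_Q cov U.cl_closed[OF y]] by blast
    then have "U.cl y = U.cl \<zero>" using U.Q_mult[OF y one_closed] U.Q_one U.Q_zero y by simp
    then show "y \<otimes> \<one> = \<zero>" using S_u_quotient_eq_zero y by simp
  qed
  have "\<forall>f \<in> F. \<exists>G. finite_cover A \<one> G \<and> (\<forall>g \<in> G. a \<otimes> f \<otimes> g \<in> (b \<otimes> f \<otimes> g) \<boxplus> (c \<otimes> f \<otimes> g))"
  proof
    fix f assume f: "f \<in> F"
    then have fc: "f \<in> carrier A" using F by blast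
    have "U.cl (a \<otimes> f) \<in> U.cl (b \<otimes> f) \<boxplus>\<^bsub>U.Q\<^esub> U.cl (c \<otimes> f)"
      using loc[of "U.cl f"] f F(3) X Y Z fc by (simp add: U.Q_mult)
    then show "\<exists>G. finite_cover A \<one> G \<and> (\<forall>g \<in> G. a \<otimes> f \<otimes> g \<in> (b \<otimes> f \<otimes> g) \<boxplus> (c \<otimes> f \<otimes> g))"
      using S_u_quotient_add_iff[of "a \<otimes> f" "b \<otimes> f" "c \<otimes> f"] X Y Z fc by simp
  qed
  then obtain G where G: "\<And>f. f \<in> F \<Longrightarrow> finite_cover A \<one> (G f)"
    and sum: "\<And>f g. \<lbrakk>f \<in> F; g \<in> G f\<rbrakk> \<Longrightarrow> a \<otimes> f \<otimes> g \<in> (b \<otimes> f \<otimes> g) \<boxplus> (c \<otimes> f \<otimes> g)"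
    using bchoice[of F] by metis
  have "a \<otimes> (f \<otimes> g) \<in> (b \<otimes> (f \<otimes> g)) \<boxplus> (c \<otimes> (f \<otimes> g))" if "f \<in> F" "g \<in> G f" for f g
  proof -
    have "f \<in> carrier A" "g \<in> carrier A" using that F finite_cover_carrier[OF G] by blast+
    then show ?thesis using sum[OF that] X Y Z by (simp add: m_assoc)
  qed
  then have "\<forall>e \<in> (\<Union>f \<in> F. (\<lambda>g. f \<otimes> g) ` G f). a \<otimes> e \<in> (b \<otimes> e) \<boxplus> (c \<otimes> e)" by blast
  moreover have "finite_cover A \<one> (\<Union>f \<in> F. (\<lambda>g. f \<otimes> g) ` G f)"
    by (rule finite_cover_UN[OF covF G])
  ultimately show "X \<in> Y \<boxplus>\<^bsub>U.Q\<^esub> Z"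
    using S_u_quotient_add_iff[OF X(1) Y(1) Z(1)] X(2) Y(2) Z(2) by blast
qed

text \<open>Morphisms preserve the local relations behind the sum, and the image of a cover of \<open>\<one>\<close> lies in no
  proper ideal of \<open>B\<close>, because the preimage of such an ideal would contain the cover but not \<open>\<one>\<close>. In a
  mono-multiring local relations are global.\<close>

lemma hom_respects_S_u_quotient_sum:
  assumes B: "mono_multiring B" and f: "f \<in> multiring_hom A B"
    and abc: "a \<in> carrier A" "b \<in> carrier A" "c \<in> carrier A"
    and sum: "U.cl a \<in> U.cl b \<boxplus>\<^bsub>U.Q\<^esub> U.cl c"
  shows "f a \<in> f b \<boxplus>\<^bsub>B\<^esub> f c"
proof -
  interpret B: mono_multiring B by fact
  have fc: "\<And>a. a \<in> carrier A \<Longrightarrow> f a \<in> carrier B"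
    and add: "\<And>a b c. \<lbrakk>a \<in> carrier A; b \<in> carrier A; c \<in> carrier A; a \<in> b \<boxplus> c\<rbrakk> \<Longrightarrow> f a \<in> f b \<boxplus>\<^bsub>B\<^esub> f c"
    and mult: "\<And>a b. \<lbrakk>a \<in> carrier A; b \<in> carrier A\<rbrakk> \<Longrightarrow> f (a \<otimes> b) = f a \<otimes>\<^bsub>B\<^esub> f b"
    and one: "f \<one> = \<one>\<^bsub>B\<^esub>"
    using f unfolding multiring_hom_def by auto
  obtain F where F: "finite_cover A \<one> F" "\<And>e. e \<in> F \<Longrightarrow> a \<otimes> e \<in> (b \<otimes> e) \<boxplus> (c \<otimes> e)"
    using sum S_u_quotient_add_iff[OF abc] by blast
  have Fc: "F \<subseteq> carrier A" using F(1) unfolding finite_cover_def by blast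
  show ?thesis
  proof (rule B.sum_from_cover[of _ _ _ "f ` F"])
    fix I assume I: "multiring_ideal B I" "f ` F \<subseteq> I"
    have "F \<subseteq> {x \<in> carrier A. f x \<in> I}" using I(2) Fc by blast
    then have "\<one> \<in> {x \<in> carrier A. f x \<in> I}"
      using finite_cover_one_in_ideal[OF F(1)] vimage_ideal[OF multiring_axioms B.multiring_axioms f I(1)] by blast
    then show "\<one>\<^bsub>B\<^esub> \<in> I" using one by simp
  next
    fix d assume "d \<in> f ` F"
    then obtain e where e: "e \<in> F" "d = f e" by blast
    then have ec: "e \<in> carrier A" using Fc by blast
    have "f (a \<otimes> e) \<in> f (b \<otimes> e) \<boxplus>\<^bsub>B\<^esub> f (c \<otimes> e)" using add F(2)[OF e(1)] abc ec by simp
    then show "f a \<otimes>\<^bsub>B\<^esub> d \<in> (f b \<otimes>\<^bsub>B\<^esub> d) \<boxplus>\<^bsub>B\<^esub> (f c \<otimes>\<^bsub>B\<^esub> d)" using mult abc ec e(2) by simp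
  qed (use fc abc Fc in auto)
qed

text \<open>Equality of classes is the relation \<open>[a] \<in> [b] \<boxplus> [\<zero>]\<close>, so that preservation of sums
  already makes \<open>f\<close> constant on classes.\<close>

lemma S_u_quotient_universal:
  assumes B: "mono_multiring B" and f: "f \<in> multiring_hom A B"
  shows "\<exists>!g. g \<in> multiring_hom U.Q B \<and> g \<in> extensional (carrier U.Q) \<and> (\<forall>a \<in> carrier A. g (U.cl a) = f a)"
proof -
  interpret B: mono_multiring B by fact
  have fc: "\<And>a. a \<in> carrier A \<Longrightarrow> f a \<in> carrier B"
    and mult: "\<And>a b. \<lbrakk>a \<in> carrier A; b \<in> carrier A\<rbrakk> \<Longrightarrow> f (a \<otimes> b) = f a \<otimes>\<^bsub>B\<^esub> f b"
    and neg: "\<And>a. a \<in> carrier A \<Longrightarrow> f (\<boxminus> a) = \<boxminus>\<^bsub>B\<^esub> f a"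
    and zero: "f \<zero> = \<zero>\<^bsub>B\<^esub>" and one: "f \<one> = \<one>\<^bsub>B\<^esub>"
    using f unfolding multiring_hom_def by auto
  have resp: "f a = f b" if ab: "a \<in> carrier A" "b \<in> carrier A" "U.cl a = U.cl b" for a b
  proof -
    have "U.cl a \<in> U.cl b \<boxplus>\<^bsub>U.Q\<^esub> U.cl \<zero>" using U.Q_addI[of b b \<zero>] ab by simp
    then have "f a \<in> f b \<boxplus>\<^bsub>B\<^esub> f \<zero>" using hom_respects_S_u_quotient_sum[OF B f] ab by simp
    then show ?thesis using zero fc ab by simp
  qed
  define g where "g = (\<lambda>X \<in> carrier U.Q. f (SOME a. a \<in> carrier A \<and> X = U.cl a))"
  have g: "g (U.cl a) = f a" if a: "a \<in> carrier A" for a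
  proof -
    let ?r = "SOME b. b \<in> carrier A \<and> U.cl a = U.cl b"
    have "?r \<in> carrier A \<and> U.cl a = U.cl ?r" by (rule someI[of _ a]) (simp add: a)
    then have "f ?r = f a" using resp a by metis
    then show ?thesis unfolding g_def using U.cl_closed[OF a] by simp
  qed
  have "g \<in> multiring_hom U.Q B"
    unfolding multiring_hom_def
  proof (intro CollectI conjI ballI impI)
    show "g \<in> carrier U.Q \<rightarrow> carrier B" using g fc by (auto elim!: U.Q_carrierE)
    show "g \<zero>\<^bsub>U.Q\<^esub> = \<zero>\<^bsub>B\<^esub>" "g \<one>\<^bsub>U.Q\<^esub> = \<one>\<^bsub>B\<^esub>" using g zero one U.Q_zero U.Q_one by simp_all
  next
    fix X assume "X \<in> carrier U.Q"
    then obtain a where "a \<in> carrier A" "X = U.cl a" by (rule U.Q_carrierE)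
    then show "g (\<boxminus>\<^bsub>U.Q\<^esub> X) = \<boxminus>\<^bsub>B\<^esub> g X" using g neg by (simp add: U.Q_neg)
  next
    fix X Y assume "X \<in> carrier U.Q" "Y \<in> carrier U.Q"
    then obtain a b where "a \<in> carrier A" "X = U.cl a" "b \<in> carrier A" "Y = U.cl b"
      by (auto elim!: U.Q_carrierE)
    then show "g (X \<otimes>\<^bsub>U.Q\<^esub> Y) = g X \<otimes>\<^bsub>B\<^esub> g Y" using g mult by (simp add: U.Q_mult)
  next
    fix X Y Z assume "X \<in> carrier U.Q" "Y \<in> carrier U.Q" "Z \<in> carrier U.Q" and sum: "X \<in> Y \<boxplus>\<^bsub>U.Q\<^esub> Z"
    then obtain a b c where "a \<in> carrier A" "X = U.cl a" "b \<in> carrier A" "Y = U.cl b"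
      "c \<in> carrier A" "Z = U.cl c" by (auto elim!: U.Q_carrierE)
    then show "g X \<in> g Y \<boxplus>\<^bsub>B\<^esub> g Z"
      using g hom_respects_S_u_quotient_sum[OF B f] sum by simp
  qed
  moreover have "g \<in> extensional (carrier U.Q)" unfolding g_def by simp
  moreover have "g' = g"
    if "g' \<in> extensional (carrier U.Q)" "\<forall>a \<in> carrier A. g' (U.cl a) = f a" for g'
  proof (rule extensionalityI[OF that(1) \<open>g \<in> extensional (carrier U.Q)\<close>])
    fix X assume "X \<in> carrier U.Q"
    then obtain a where "a \<in> carrier A" "X = U.cl a" by (rule U.Q_carrierE)
    then show "g' X = g X" using g that(2) by simp
  qed
  ultimately show ?thesis using g by blast
qed

end

theorem corollary3p9:
  fixes A :: "'a multiring"
  assumes "von_neumann_hyperring A"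
  shows "von_neumann_hyperring (marshall_quotient A (S_u A))
    \<and> geometric_multiring (marshall_quotient A (S_u A))
    \<and> (\<forall>(B :: 'b multiring) f.
         mono_multiring B \<and> f \<in> multiring_hom A B \<longrightarrow>
         (\<exists>!g. g \<in> multiring_hom (marshall_quotient A (S_u A)) B
            \<and> g \<in> extensional (carrier (marshall_quotient A (S_u A)))
            \<and> (\<forall>a \<in> carrier A. g (marshall_proj A (S_u A) a) = f a)))"
proof -
  interpret von_neumann_hyperring A by fact
  interpret Q: local_von_neumann_hyperring "marshall_quotient A (S_u A)"
    by (rule S_u_quotient_local)
  show ?thesis
    using Q.von_neumann_hyperring_axioms Q.geometric S_u_quotient_universal by blast
qed

end
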